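(* Let $0<\beta<1$, $x_0>0$, $0\le\mu<1$ and $p>1/\beta$. Assume: (1) $\phi$ is a nonnegative, continuous and nondecreasing function on $[0,+\infty)$, and there exists a nonnegative constant $M$ such that $|\phi(t)|\le M t^{\mu}$ for all $t\in[0,+\infty)$; (2) $t^{\beta}l(t)$ is a nonnegative, continuous and nonincreasing function on $(0,+\infty)$, and $t^{(1-\mu)(1-\beta)}l(t)\in L^{p}[0,1]$; (3) $t^{\beta}k(t)$ is a nonnegative, continuous and nonincreasing function on $(0,+\infty)$, and $t^{1-\beta}k(t)\in L^{p}[0,1]$. Let $a=\lim_{t\to+\infty}t^{\beta}l(t)$ and $b=\lim_{t\to+\infty}t^{\beta}k(t)$ (these limits exist by monotonicity). Suppose there exists a unique nonnegative constant $\kappa$ that satisfies the equation $$x=\frac{\pi}{\Gamma(\beta)\sin(\beta\pi)}\bigl(a\phi(x)+b\bigr).$$ Then the Riemann-Liouville fractional differential equation $$D_{0^{+}}^{\beta}x(t)=l(t)\phi(x(t))+k(t),\quad t\in(0,+\infty),\qquad \lim_{t\to0^{+}}t^{1-\beta}x(t)=x_{0},$$ has at least one decreasing solution $x\in C^{+}_{1-\beta}(0,+\infty)$ with $\lim_{t\to+\infty}x(t)=\kappa$.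
   Context: The Riemann-Liouville fractional integral of order $\alpha\in(0,1)$ is $I_{0^{+}}^{\alpha}\rho(t)=\frac{1}{\Gamma(\alpha)}\int_{0}^{t}(t-s)^{\alpha-1}\rho(s)\,ds$. The Riemann-Liouville fractional derivative of order $\beta\in(0,1)$ is $D_{0^{+}}^{\beta}\rho(t)=\frac{d}{dt}I_{0^{+}}^{1-\beta}\rho(t)=\frac{1}{\Gamma(1-\beta)}\frac{d}{dt}\int_{0}^{t}(t-s)^{-\beta}\rho(s)\,ds$, where $I_{0^{+}}^{1-\beta}\rho$ is an absolutely continuous function. For $\alpha\in(0,1)$, $C^{+}_{\alpha}(0,+\infty)$ is the set of nonnegative continuous functions $x$ on $(0,+\infty)$ such that $t^{\alpha}x(t)$ is (extends to) a nonnegative continuous function on $[0,+\infty)$. A solution is a function satisfying both the differential equation for all $t\in(0,+\infty)$ and the initial condition. "Decreasing" means strictly decreasing, as distinguished from "nonincreasing". When $\mu=0$, $t^{\mu}=1$ for all $t\ge0$, including $t=0$. *)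

theory Defs
  imports "HOL-Analysis.Analysis"
begin

(* powr has 0 powr 0 = 0, whereas the growth condition on the nonlinearity uses
   the convention t^0 = 1 also at t = 0. *)
definition rpow :: "real \<Rightarrow> real \<Rightarrow> real" where
  "rpow t \<mu> = (if \<mu> = 0 then 1 else t powr \<mu>)"

definition in_Lp :: "real \<Rightarrow> real set \<Rightarrow> (real \<Rightarrow> real) \<Rightarrow> bool" where
  "in_Lp p S f \<longleftrightarrow> set_borel_measurable lebesgue S f
     \<and> set_integrable lebesgue S (\<lambda>t. \<bar>f t\<bar> powr p)"

(* Absolute continuity of a real function on an interval S; each pair (u, v) in D
   stands for a subinterval. (absolutely_continuous in HOL-Analysis is about measures.) *)
definition abs_cont_on :: "real set \<Rightarrow> (real \<Rightarrow> real) \<Rightarrow> bool" where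
  "abs_cont_on S f \<longleftrightarrow> (\<forall>\<epsilon>>0. \<exists>\<delta>>0. \<forall>D.
     finite D \<and> (\<forall>(u, v)\<in>D. u \<in> S \<and> v \<in> S \<and> u < v)
       \<and> disjoint_family_on (\<lambda>(u, v). {u<..<v}) D
       \<and> (\<Sum>(u, v)\<in>D. v - u) < \<delta>
     \<longrightarrow> (\<Sum>(u, v)\<in>D. \<bar>f v - f u\<bar>) < \<epsilon>)"

definition rl_integrand :: "real \<Rightarrow> (real \<Rightarrow> real) \<Rightarrow> real \<Rightarrow> real \<Rightarrow> real" where
  "rl_integrand \<alpha> \<rho> t s = (t - s) powr (\<alpha> - 1) * \<rho> s"

definition rl_integral :: "real \<Rightarrow> (real \<Rightarrow> real) \<Rightarrow> real \<Rightarrow> real" where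
  "rl_integral \<alpha> \<rho> t =
     1 / Gamma \<alpha> * set_lebesgue_integral lebesgue {0<..<t} (rl_integrand \<alpha> \<rho> t)"

(* rho has Riemann-Liouville derivative d of order beta at every t > 0.
   Integrability is demanded explicitly, since the Bochner integral of a
   non-integrable function is 0 by convention. Absolute continuity is demanded on
   every (0, T], which amounts to absolute continuity on [0, T] of the continuous
   extension to 0: rl_integral (1 - beta) rho 0 is 0 by convention, while for
   t^(1 - beta) * rho t --> x0 one has rl_integral (1 - beta) rho t --> Gamma beta * x0
   as t --> 0+. *)
definition has_rl_derivative :: "real \<Rightarrow> (real \<Rightarrow> real) \<Rightarrow> (real \<Rightarrow> real) \<Rightarrow> bool" where
  "has_rl_derivative \<beta> \<rho> d \<longleftrightarrow>
     (\<forall>t>0. set_integrable lebesgue {0<..<t} (rl_integrand (1 - \<beta>) \<rho> t))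
     \<and> (\<forall>T>0. abs_cont_on {0<..T} (rl_integral (1 - \<beta>) \<rho>))
     \<and> (\<forall>t>0. (rl_integral (1 - \<beta>) \<rho> has_real_derivative d t) (at t))"

(* Functions on (0, infinity) are functions on real whose values at t <= 0 are irrelevant. *)
definition C_plus :: "real \<Rightarrow> (real \<Rightarrow> real) set" where
  "C_plus \<alpha> = {x. continuous_on {0<..} x \<and> (\<forall>t>0. x t \<ge> 0)
     \<and> (\<exists>g. continuous_on {0..} g \<and> (\<forall>t\<ge>0. g t \<ge> 0) \<and> (\<forall>t>0. g t = t powr \<alpha> * x t))}"

definition rl_ivp_solution ::
  "real \<Rightarrow> (real \<Rightarrow> real) \<Rightarrow> (real \<Rightarrow> real) \<Rightarrow> (real \<Rightarrow> real) \<Rightarrow> real \<Rightarrow> (real \<Rightarrow> real) \<Rightarrow> bool" where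
  "rl_ivp_solution \<beta> l \<phi> k x0 x \<longleftrightarrow>
     has_rl_derivative \<beta> x (\<lambda>t. l t * \<phi> (x t) + k t)
     \<and> ((\<lambda>t. t powr (1 - \<beta>) * x t) \<longlongrightarrow> x0) (at_right 0)"

end

theory Submission
  imports Defs
begin

text \<open>
  The initial value problem is solved through the Volterra equation
  \[ x(t) = x_0 t^{\beta-1} + \frac{1}{\Gamma(\beta)} \int_0^t (t-s)^{\beta-1} \bigl(l(s)\phi(x(s)) + k(s)\bigr)\,ds. \]
  Put $G(s) = s^\beta l(s)\phi(x(s)) + s^\beta k(s)$ and substitute $s = tu$. All powers of $t$ cancel, and
  the integral becomes the weighted mean
  $\int_0^1 (1-u)^{\beta-1} u^{-\beta} G(tu)\,du$, with a weight that does not depend on $t$. If $x$ is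
  nonincreasing, then so is $G$, because $t^\beta l$, $t^\beta k$ are nonincreasing and $\phi$ is
  nondecreasing; hence the mean is nonincreasing in $t$, and $x_0 t^{\beta-1}$ makes the right-hand side
  strictly decreasing. Moreover the right-hand side depends monotonically on $x$. So order takes
  the place of compactness: the Picard iterates that start at the zero function form an increasing sequence of
  nonincreasing functions, and it only remains to bound them (\<open>monotone_iteration\<close>).

  For the bound it suffices to look at $(0,1]$, since the iterates are nonincreasing. There, the
  $L^p$ hypotheses and monotonicity give pointwise power bounds for $l$ and $k$
  (\<open>Lp_imp_pointwise_bound\<close>), which replaces Hoelder's inequality. They turn $x(s) \le R s^{\beta-1}$ into
  $G(s) \le C s^e$ with $e = 2\beta - 1 - 1/p$ and $C$ of order $R^\mu$. The condition $p > 1/\beta$ says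
  exactly that $e > \beta - 1$; so the mean of $G$ is finite, it is dominated by $t^{\beta-1}$ near $0$, and
  since $\mu < 1$, a large $R$ reproduces itself.

  Dominated convergence for the means (\<open>abel_mean_LIMSEQ\<close>) then serves three times: for the limit of the
  iterates, for the continuity of the solution (a monotone $G$ has only countably many discontinuities), and for
  $t \to \infty$. In the last case the nonincreasing $x$ tends to some $c \ge 0$, the mean tends to
  $\Gamma(\beta)\Gamma(1-\beta)(a\phi(c)+b)$, and the reflection formula shows that $c$ satisfies the equation for
  $\kappa$; uniqueness of $\kappa$ yields $c = \kappa$.

  Finally, Tonelli's theorem gives $I^{1-\beta} I^\beta f = \int_0^t f$ (\<open>nn_integral_abel_compose\<close>), so
  $I^{1-\beta} x(t) = \Gamma(\beta) x_0 + \int_0^t s^{-\beta} G(s)\,ds$ (\<open>rl_integral_abel\<close>). This function is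
  absolutely continuous, and its derivative is $t^{-\beta} G(t) = l(t)\phi(x(t)) + k(t)$.
\<close>

section \<open>The weighted mean behind the fractional integral\<close>

text \<open>The weight on $(0,1)$ that arises from $(t-s)^{\beta-1} s^{-\beta}\,ds$ under $s = tu$; the factor
  $t^{\beta-1} \cdot t^{-\beta} \cdot t$ is $1$.\<close>
definition kern :: "real \<Rightarrow> real \<Rightarrow> real" where
  "kern \<beta> u = indicator {0<..<1} u * ((1 - u) powr (\<beta> - 1) * u powr (-\<beta>))"

text \<open>The fractional integral of order $\beta$ of $s^{-\beta} G(s)$, written as a mean of dilates of $G$
  (see \<open>abel_mean_eq_integral\<close>). In this form monotonicity in $t$ and in $G$ is immediate.\<close>
definition abel_mean :: "real \<Rightarrow> (real \<Rightarrow> real) \<Rightarrow> real \<Rightarrow> real" where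
  "abel_mean \<beta> G t = (LINT u|lborel. kern \<beta> u * G (t * u)) / Gamma \<beta>"

text \<open>The one class of functions in which everything takes place: solution candidates are profiles
  with exponent $\beta-1$, and the functions $s^\beta l(s)\phi(x(s)) + s^\beta k(s)$ are profiles with some exponent
  $e > \beta-1$. Growth needs to be controlled on $(0,1]$ only, as monotonicity takes care of the rest.\<close>
definition profile :: "real \<Rightarrow> real \<Rightarrow> (real \<Rightarrow> real) \<Rightarrow> bool" where
  "profile e C G \<longleftrightarrow> antimono_on {0<..} G \<and> (\<forall>s>0. 0 \<le> G s) \<and> (\<forall>s. 0 < s \<and> s \<le> 1 \<longrightarrow> G s \<le> C * s powr e)"

lemma Gamma_reflection_real:
  "Gamma z * Gamma (1 - z) = pi / sin (pi * z)" for z :: real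
proof -
  have "complex_of_real (Gamma z * Gamma (1 - z)) = Gamma (of_real z) * Gamma (1 - of_real z)"
    by (simp flip: Gamma_complex_of_real)
  also have "\<dots> = of_real (pi / sin (pi * z))"
    by (simp add: Gamma_reflection_complex flip: sin_of_real)
  finally show ?thesis using of_real_eq_iff by blast
qed

lemma kern_nonneg: "0 \<le> kern \<beta> u"
  by (simp add: kern_def)

lemma kern_measurable[measurable]: "kern \<beta> \<in> borel_measurable borel"
  unfolding kern_def[abs_def] by measurable

lemma nn_integral_Beta:
  assumes "0 < a" "0 < b"
  shows "(\<integral>\<^sup>+u. ennreal (indicator {0<..<1} u * (u powr (a - 1) * (1 - u) powr (b - 1))) \<partial>lborel) = ennreal (Beta a b)"
proof -
  have "(\<integral>\<^sup>+u. ennreal (indicator {0..1} u * (u powr (a - 1) * (1 - u) powr (b - 1))) \<partial>lborel) = ennreal (Beta a b)"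
    using has_integral_Beta_real[OF assms]
    by (intro nn_integral_has_integral_lebesgue) (auto)
  moreover have "indicator {0<..<1} u * (u powr (a - 1) * (1 - u) powr (b - 1)) = indicator {0..1} u * (u powr (a - 1) * (1 - u) powr (b - 1))" for u :: real
    by (auto simp: indicator_def)
  ultimately show ?thesis by presburger
qed

lemma Beta_pos: "0 < a \<Longrightarrow> 0 < b \<Longrightarrow> 0 < Beta a (b::real)"
  by (simp add: Beta_def)

text \<open>The indicator removes the values at nonpositive arguments, about which nothing is known.\<close>
lemma antimono_measurable:
  fixes G :: "real \<Rightarrow> real"
  assumes "antimono_on {0<..} G"
  shows "(\<lambda>s. indicator {0<..} s * G s) \<in> borel_measurable borel"
proof -
  have "mono_on {0<..} (\<lambda>s. - G s)" using assms by (auto simp: monotone_on_def)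
  from borel_measurable_mono_on_fnc[OF this]
  have "(\<lambda>s. - (- G s)) \<in> borel_measurable (restrict_space borel {0<..})"
    by (rule borel_measurable_uminus)
  then show ?thesis by (simp add: borel_measurable_restrict_space_iff)
qed

lemma antimono_countable_discont:
  fixes G :: "real \<Rightarrow> real"
  assumes "antimono_on {0<..} G"
  shows "countable {s\<in>{0<..}. \<not> isCont G s}"
proof -
  have "mono_on {0<..} (\<lambda>s. - G s)" using assms by (auto simp: monotone_on_def)
  from mono_on_ctble_discont_open[OF _ this] have "countable {s\<in>{0<..}. \<not> isCont (\<lambda>s. - G s) s}" by simp
  moreover have "isCont (\<lambda>s. - G s) s \<Longrightarrow> isCont G s" for s
    using isCont_minus[of s "\<lambda>s. - G s"] by simp
  ultimately show ?thesis by (elim countable_subset[rotated]) auto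
qed

text \<open>A bound that holds on the whole half-line without case distinction, as needed for an integrable majorant
  of $u \mapsto G(tu)$ when $t > 1$.\<close>
lemma profile_bound:
  assumes "profile e C G" "0 < s"
  shows "G s \<le> C * (1 + s powr e)" and "0 \<le> C"
proof -
  have "0 \<le> G 1" "G 1 \<le> C" using assms by (auto simp: profile_def dest: spec[of _ 1])
  then show C: "0 \<le> C" by simp
  show "G s \<le> C * (1 + s powr e)"
  proof (cases "s \<le> 1")
    case True
    then have "G s \<le> C * s powr e" using assms by (auto simp: profile_def)
    with C show ?thesis by (simp add: algebra_simps)
  next
    case False
    then have "G s \<le> G 1" using assms by (auto simp: profile_def monotone_on_def)
    also note \<open>G 1 \<le> C\<close>
    also have "C \<le> C * (1 + s powr e)" using C by (simp add: algebra_simps)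
    finally show ?thesis .
  qed
qed

text \<open>The condition on $e$ is what makes $u^e$ integrable against the weight, whose singularity at $0$ is
  $u^{-\beta}$.\<close>
locale abel =
  fixes \<beta> e :: real
  assumes beta: "0 < \<beta>" "\<beta> < 1" and e: "\<beta> - 1 < e"
begin

lemma kern_powr:
  assumes "\<beta> - 1 < r"
  shows "has_bochner_integral lborel (\<lambda>u. kern \<beta> u * u powr r) (Beta (1 - \<beta> + r) \<beta>)"
proof (rule has_bochner_integral_nn_integral)
  have eq: "kern \<beta> u * u powr r = indicator {0<..<1} u * (u powr ((1 - \<beta> + r) - 1) * (1 - u) powr (\<beta> - 1))" for u
    by (auto simp: kern_def indicator_def powr_add[symmetric])
  show "(\<integral>\<^sup>+u. ennreal (kern \<beta> u * u powr r) \<partial>lborel) = ennreal (Beta (1 - \<beta> + r) \<beta>)"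
    unfolding eq by (rule nn_integral_Beta) (use assms beta in auto)
  show "0 \<le> Beta (1 - \<beta> + r) \<beta>" using Beta_pos[of "1 - \<beta> + r" \<beta>] assms beta by simp
qed (auto simp: kern_nonneg)

lemma kern_integral: "has_bochner_integral lborel (kern \<beta>) (Gamma (1 - \<beta>) * Gamma \<beta>)"
proof -
  have "(\<lambda>u. kern \<beta> u * u powr 0) = kern \<beta>" by (auto simp: kern_def indicator_def)
  then show ?thesis using kern_powr[of 0] beta by (simp add: Beta_def del: powr_0)
qed

definition majorant :: "real \<Rightarrow> real \<Rightarrow> real \<Rightarrow> real" where
  "majorant C t u = C * (kern \<beta> u + t powr e * (kern \<beta> u * u powr e))"

lemma majorant:
  "has_bochner_integral lborel (majorant C t) (C * (Gamma (1 - \<beta>) * Gamma \<beta> + t powr e * Beta (1 - \<beta> + e) \<beta>))"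
  unfolding majorant_def[abs_def]
  by (intro has_bochner_integral_mult_right has_bochner_integral_add kern_integral kern_powr e)

lemma kern_le_majorant:
  assumes "profile e C G" "0 < t"
  shows "0 \<le> kern \<beta> u * G (t * u)" "kern \<beta> u * G (t * u) \<le> majorant C t u"
proof -
  show "0 \<le> kern \<beta> u * G (t * u)"
    using assms by (auto simp: kern_def indicator_def profile_def)
  show "kern \<beta> u * G (t * u) \<le> majorant C t u"
  proof (cases "u \<in> {0<..<1}")
    case True
    then have "G (t * u) \<le> C * (1 + (t * u) powr e)" using assms by (intro profile_bound) auto
    also have "\<dots> = C * (1 + t powr e * u powr e)" using True assms by (simp add: powr_mult)
    finally have "kern \<beta> u * G (t * u) \<le> kern \<beta> u * (C * (1 + t powr e * u powr e))"
      by (intro mult_left_mono kern_nonneg)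
    then show ?thesis by (simp add: majorant_def algebra_simps)
  qed (auto simp: kern_def majorant_def)
qed

lemma kern_profile_measurable:
  assumes "antimono_on {0<..} G" "0 < t"
  shows "(\<lambda>u. kern \<beta> u * G (t * u)) \<in> borel_measurable borel"
proof -
  have "(\<lambda>u. kern \<beta> u * ((\<lambda>s. indicator {0<..} s * G s) (t * u))) \<in> borel_measurable borel"
    by (intro borel_measurable_times kern_measurable measurable_compose[OF _ antimono_measurable[OF assms(1)]]) auto
  also have "(\<lambda>u. kern \<beta> u * ((\<lambda>s. indicator {0<..} s * G s) (t * u))) = (\<lambda>u. kern \<beta> u * G (t * u))"
    using assms by (auto simp: kern_def indicator_def fun_eq_iff zero_less_mult_iff)
  finally show ?thesis .
qed

lemma profile_integrable:
  assumes "profile e C G" "0 < t"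
  shows "integrable lborel (\<lambda>u. kern \<beta> u * G (t * u))"
proof (rule Bochner_Integration.integrable_bound)
  show "integrable lborel (majorant C t)" using majorant by (rule integrable.intros)
qed (use assms kern_le_majorant[OF assms] kern_profile_measurable[of G t] in \<open>auto simp: profile_def abs_of_nonneg intro!: AE_I2 order_trans[OF _ abs_ge_self]\<close>)

end

context abel begin

lemma Gamma_beta_pos: "0 < Gamma \<beta>" "0 < Gamma (1 - \<beta>)"
  using beta by (auto intro: Gamma_real_pos)

lemma abel_mean_nonneg:
  assumes "profile e C G" "0 < t"
  shows "0 \<le> abel_mean \<beta> G t"
  unfolding abel_mean_def using assms Gamma_beta_pos
  by (intro divide_nonneg_pos Bochner_Integration.integral_nonneg kern_le_majorant)

lemma abel_mean_mono:
  assumes "profile e C G" "profile e C H" "0 < t" "\<And>s. 0 < s \<Longrightarrow> G s \<le> H s"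
  shows "abel_mean \<beta> G t \<le> abel_mean \<beta> H t"
  unfolding abel_mean_def
proof (intro divide_right_mono integral_mono profile_integrable)
  show "kern \<beta> u * G (t * u) \<le> kern \<beta> u * H (t * u)" for u
    using assms by (auto simp: kern_def indicator_def intro!: mult_left_mono)
qed (use assms Gamma_beta_pos in auto)

lemma abel_mean_antimono:
  assumes "profile e C G" "0 < s" "s \<le> t"
  shows "abel_mean \<beta> G t \<le> abel_mean \<beta> G s"
  unfolding abel_mean_def
proof (intro divide_right_mono integral_mono profile_integrable)
  show "kern \<beta> u * G (t * u) \<le> kern \<beta> u * G (s * u)" for u
    using assms by (auto simp: kern_def indicator_def profile_def monotone_on_def intro!: mult_left_mono)
qed (use assms Gamma_beta_pos in auto)

text \<open>For $t \le 1$ all arguments $tu$ stay in $(0,1]$, so only the power bound enters, and a power is reproduced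
  with a Beta factor.\<close>
lemma abel_mean_bound:
  assumes G: "profile e C G" and t: "0 < t" "t \<le> 1"
  shows "abel_mean \<beta> G t \<le> C * Beta (1 - \<beta> + e) \<beta> / Gamma \<beta> * t powr e"
proof -
  have int: "has_bochner_integral lborel (\<lambda>u. C * t powr e * (kern \<beta> u * u powr e))
      (C * t powr e * Beta (1 - \<beta> + e) \<beta>)"
    by (intro has_bochner_integral_mult_right kern_powr e)
  have "(LINT u|lborel. kern \<beta> u * G (t * u)) \<le> (LINT u|lborel. C * t powr e * (kern \<beta> u * u powr e))"
  proof (intro integral_mono profile_integrable[OF G] t)
    fix u
    show "kern \<beta> u * G (t * u) \<le> C * t powr e * (kern \<beta> u * u powr e)"
    proof (cases "u \<in> {0<..<1}")
      case True
      with t have "t * u \<le> 1" by (simp add: mult_le_one)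
      then have "G (t * u) \<le> C * (t * u) powr e" using True t G by (simp add: profile_def)
      then have "kern \<beta> u * G (t * u) \<le> kern \<beta> u * (C * (t * u) powr e)"
        by (intro mult_left_mono kern_nonneg)
      then show ?thesis using True t by (simp add: powr_mult algebra_simps)
    qed (auto simp: kern_def)
  qed (use int in \<open>rule integrable.intros\<close>)
  also have "\<dots> = C * t powr e * Beta (1 - \<beta> + e) \<beta>"
    using int by (rule has_bochner_integral_integral_eq)
  finally show ?thesis
    using Gamma_beta_pos by (simp add: abel_mean_def field_simps)
qed

text \<open>The function and the dilation factor may vary at the same time. One majorant suffices: profiles are nonincreasing,
  so factors $t_n \ge t_0$ can be replaced by $t_0$ in the estimate.\<close>
lemma abel_mean_LIMSEQ:
  assumes H: "\<And>n. profile e C (H n)"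
    and "0 < t0" and t: "\<forall>\<^sub>F n in sequentially. t0 \<le> t n"
    and g: "(\<lambda>u. kern \<beta> u * g u) \<in> borel_measurable borel"
    and lim: "AE u in lborel. u \<in> {0<..<1} \<longrightarrow> (\<lambda>n. H n (t n * u)) \<longlonglongrightarrow> g u"
  shows "(\<lambda>n. abel_mean \<beta> (H n) (t n)) \<longlonglongrightarrow> (LINT u|lborel. kern \<beta> u * g u) / Gamma \<beta>"
proof -
  obtain N where N: "\<And>n. t0 \<le> t (n + N)"
    using t by (metis eventually_sequentially le_add2)
  have "(\<lambda>n. LINT u|lborel. kern \<beta> u * H (n + N) (t (n + N) * u)) \<longlonglongrightarrow> (LINT u|lborel. kern \<beta> u * g u)"
  proof (rule integral_dominated_convergence)
    show "integrable lborel (majorant C t0)" using majorant by (rule integrable.intros)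
    show "(\<lambda>u. kern \<beta> u * g u) \<in> borel_measurable lborel" using g by simp
    show "(\<lambda>u. kern \<beta> u * H (n + N) (t (n + N) * u)) \<in> borel_measurable lborel" for n
      using kern_profile_measurable[of "H (n + N)" "t (n + N)"] N[of n] \<open>0 < t0\<close> H by (simp add: profile_def)
    show "AE u in lborel. (\<lambda>n. kern \<beta> u * H (n + N) (t (n + N) * u)) \<longlonglongrightarrow> kern \<beta> u * g u"
      using lim
    proof eventually_elim
      case (elim u)
      show ?case
      proof (cases "u \<in> {0<..<1}")
        case True
        with elim have "(\<lambda>n. H (n + N) (t (n + N) * u)) \<longlonglongrightarrow> g u"
          using LIMSEQ_ignore_initial_segment by blast
        then show ?thesis by (intro tendsto_mult tendsto_const)
      qed (auto simp: kern_def)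
    qed
    show "AE u in lborel. norm (kern \<beta> u * H (n + N) (t (n + N) * u)) \<le> majorant C t0 u" for n
    proof (rule AE_I2)
      fix u
      have "kern \<beta> u * H (n + N) (t (n + N) * u) \<le> kern \<beta> u * H (n + N) (t0 * u)"
        using H[of "n + N"] N[of n] \<open>0 < t0\<close>
        by (auto simp: kern_def indicator_def profile_def monotone_on_def intro!: mult_left_mono)
      also have "\<dots> \<le> majorant C t0 u" by (intro kern_le_majorant H \<open>0 < t0\<close>)
      finally show "norm (kern \<beta> u * H (n + N) (t (n + N) * u)) \<le> majorant C t0 u"
        using kern_le_majorant(1)[OF H[of "n + N"], of "t (n + N)" u] N[of n] \<open>0 < t0\<close> by simp
    qed
  qed
  then have "(\<lambda>n. abel_mean \<beta> (H (n + N)) (t (n + N))) \<longlonglongrightarrow> (LINT u|lborel. kern \<beta> u * g u) / Gamma \<beta>"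
    unfolding abel_mean_def using Gamma_beta_pos by (intro tendsto_divide tendsto_const) auto
  then show ?thesis by (rule LIMSEQ_offset)
qed

text \<open>A monotone function has only countably many discontinuities, so for fixed $t$ the dilates $G(t'u)$ converge to
  $G(tu)$ as $t' \to t$ for all but countably many $u$. This is what makes solutions continuous, as the monotone limit
  of the iterates carries no continuity of its own.\<close>
lemma abel_mean_continuous:
  assumes G: "profile e C G"
  shows "continuous_on {0<..} (abel_mean \<beta> G)"
proof -
  have "isCont (abel_mean \<beta> G) t" if "0 < t" for t
    unfolding isCont_def tendsto_at_iff_sequentially o_def
  proof (intro allI impI)
    fix X assume X: "X \<longlonglongrightarrow> t"
    have G': "antimono_on {0<..} G" using G by (simp add: profile_def)
    have "(\<lambda>n. abel_mean \<beta> G (X n)) \<longlonglongrightarrow> (LINT u|lborel. kern \<beta> u * G (t * u)) / Gamma \<beta>"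
    \<comment> \<open>Eventually the sequence stays above $t/2$, which provides the uniform lower bound for the dilation factors.\<close>
    proof (rule abel_mean_LIMSEQ[of C "\<lambda>_. G" "t/2" X "\<lambda>u. G (t * u)", OF G])
      show "\<forall>\<^sub>F n in sequentially. t / 2 \<le> X n"
        using order_tendstoD(1)[OF X, of "t/2"] \<open>0 < t\<close> by (auto elim: eventually_mono)
      have "countable ((\<lambda>s. s / t) ` {s\<in>{0<..}. \<not> isCont G s})"
        by (intro countable_image antimono_countable_discont G')
      from AE_not_in[OF countable_imp_null_set_lborel[OF this]]
      show "AE u in lborel. u \<in> {0<..<1} \<longrightarrow> (\<lambda>n. G (X n * u)) \<longlonglongrightarrow> G (t * u)"
      proof (eventually_elim, intro impI)
        fix u assume "u \<notin> (\<lambda>s. s / t) ` {s\<in>{0<..}. \<not> isCont G s}" "u \<in> {0<..<1}"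
        then have "isCont G (t * u)" using \<open>0 < t\<close> by (auto simp: image_iff dest!: spec[of _ "t * u"])
        then show "(\<lambda>n. G (X n * u)) \<longlonglongrightarrow> G (t * u)"
          by (rule isCont_tendsto_compose) (intro tendsto_intros X)
      qed
    qed (use \<open>0 < t\<close> kern_profile_measurable[OF G'] in auto)
    then show "(\<lambda>n. abel_mean \<beta> G (X n)) \<longlonglongrightarrow> abel_mean \<beta> G t" by (simp add: abel_mean_def)
  qed
  then show ?thesis by (auto intro: continuous_at_imp_continuous_on)
qed

lemma abel_mean_at_top:
  assumes G: "profile e C G" and lim: "(G \<longlongrightarrow> g) at_top"
  shows "(abel_mean \<beta> G \<longlongrightarrow> Gamma (1 - \<beta>) * g) at_top"
proof (rule tendsto_at_topI_sequentially)
  fix X :: "nat \<Rightarrow> real" assume X: "filterlim X at_top sequentially"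
  have "(\<lambda>n. abel_mean \<beta> G (X n)) \<longlonglongrightarrow> (LINT u|lborel. kern \<beta> u * g) / Gamma \<beta>"
  proof (rule abel_mean_LIMSEQ[of C "\<lambda>_. G" 1 X "\<lambda>_. g", OF G])
    show "\<forall>\<^sub>F n in sequentially. 1 \<le> X n" using X by (simp add: filterlim_at_top)
    show "AE u in lborel. u \<in> {0<..<1} \<longrightarrow> (\<lambda>n. G (X n * u)) \<longlonglongrightarrow> g"
    proof (intro AE_I2 impI)
      fix u :: real assume "u \<in> {0<..<1}"
      then have "filterlim (\<lambda>n. X n * u) at_top sequentially"
        using filterlim_tendsto_pos_mult_at_top[OF tendsto_const[of u] _ X] by (simp add: mult.commute)
      then show "(\<lambda>n. G (X n * u)) \<longlonglongrightarrow> g" by (rule filterlim_compose[OF lim])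
    qed
  qed auto
  also have "(LINT u|lborel. kern \<beta> u * g) / Gamma \<beta> = Gamma (1 - \<beta>) * g"
    using has_bochner_integral_integral_eq[OF kern_integral] Gamma_beta_pos by simp
  finally show "(\<lambda>n. abel_mean \<beta> G (X n)) \<longlonglongrightarrow> Gamma (1 - \<beta>) * g" .
qed

text \<open>The mean is of order $t^e$ with $e > \beta - 1$, so it is invisible in the weighted initial condition.\<close>
lemma abel_mean_at_right_0:
  assumes G: "profile e C G"
  shows "((\<lambda>t. t powr (1 - \<beta>) * abel_mean \<beta> G t) \<longlongrightarrow> 0) (at_right 0)"
proof (rule tendsto_sandwich[OF _ _ tendsto_const])
  let ?c = "C * Beta (1 - \<beta> + e) \<beta> / Gamma \<beta>"
  have "\<forall>\<^sub>F t::real in at_right 0. 0 < t \<and> t < 1"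
    using eventually_at_right_real[of 0 "1::real"] by (auto elim: eventually_mono)
  then show "\<forall>\<^sub>F t in at_right 0. t powr (1 - \<beta>) * abel_mean \<beta> G t \<le> ?c * t powr (1 - \<beta> + e)"
  proof eventually_elim
    case (elim t)
    then have "t powr (1 - \<beta>) * abel_mean \<beta> G t \<le> t powr (1 - \<beta>) * (?c * t powr e)"
      by (intro mult_left_mono abel_mean_bound[OF G]) auto
    then show ?case by (simp add: powr_add mult_ac)
  qed
  show "\<forall>\<^sub>F t in at_right 0. 0 \<le> t powr (1 - \<beta>) * abel_mean \<beta> G t"
    using eventually_at_right_less[of "0::real"] by eventually_elim (intro mult_nonneg_nonneg abel_mean_nonneg[OF G] powr_ge_zero)
  have "((\<lambda>t. t powr (1 - \<beta> + e)) \<longlongrightarrow> 0) (at_right (0::real))"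
    using e tendsto_powr'[of "\<lambda>t. t" 0 "at_right (0::real)" "\<lambda>_. 1 - \<beta> + e" "1 - \<beta> + e"]
    by (auto simp: eventually_at_filter)
  from tendsto_mult_left[OF this, of ?c] show "((\<lambda>t. ?c * t powr (1 - \<beta> + e)) \<longlongrightarrow> 0) (at_right 0)" by simp
qed

end

section \<open>Indefinite integrals on an open half-line\<close>

text \<open>Truncation: $|f| \le N + (|f|-N)^+$, where the integral of the second part is below $\varepsilon/2$ for
  large $N$ by dominated convergence, and the first part contributes at most $N$ times the total length.\<close>
lemma abs_cont_on_integral:
  fixes f F :: "real \<Rightarrow> real"
  assumes f: "set_integrable lborel S f"
    and F: "\<And>u v. u \<in> A \<Longrightarrow> v \<in> A \<Longrightarrow> u < v \<Longrightarrow> {u<..<v} \<subseteq> S \<and> F v - F u = (LINT r:{u<..<v}|lborel. f r)"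
  shows "abs_cont_on A F"
  unfolding abs_cont_on_def
proof (intro allI impI)
  fix \<epsilon> :: real assume "\<epsilon> > 0"
  define h where "h r = \<bar>indicator S r * f r\<bar>" for r
  have h: "integrable lborel h" using f integrable_norm[of lborel "\<lambda>r. indicator S r * f r"] by (simp add: h_def[abs_def] set_integrable_def)
  then have [measurable]: "h \<in> borel_measurable borel" by auto
  define g where "g n r = max 0 (h r - n)" for n :: real and r
  have g0: "0 \<le> g n r" "0 \<le> h r" for n r by (auto simp: g_def h_def)
  have gint: "integrable lborel (g n)" if "0 \<le> n" for n
  proof (rule Bochner_Integration.integrable_bound[OF h])
    show "g n \<in> borel_measurable lborel" unfolding g_def[abs_def] by measurable
  qed (use that in \<open>auto simp: g_def h_def\<close>)
  have "(\<lambda>n. LINT r|lborel. g (real n) r) \<longlonglongrightarrow> (LINT (r::real)|lborel. 0)"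
  proof (rule integral_dominated_convergence[OF _ _ h])
    show "AE r in lborel. (\<lambda>n. g (real n) r) \<longlonglongrightarrow> 0"
    proof (intro AE_I2 tendsto_eventually)
      fix r obtain N where "h r \<le> real N" using real_arch_simple by blast
      then show "\<forall>\<^sub>F n in sequentially. g (real n) r = 0"
        by (auto simp: eventually_sequentially g_def intro!: exI[of _ N])
    qed
    show "(\<lambda>r. g (real n) r) \<in> borel_measurable lborel" for n unfolding g_def by measurable
  qed (auto simp: g_def h_def)
  then have "\<forall>\<^sub>F n in sequentially. (LINT r|lborel. g (real n) r) < \<epsilon> / 2"
    by (rule order_tendstoD(2)) (use \<open>\<epsilon> > 0\<close> in simp)
  then obtain N where N: "(LINT r|lborel. g (real N) r) < \<epsilon> / 2" by (auto simp: eventually_sequentially)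
  define \<delta> where "\<delta> = \<epsilon> / (2 * (real N + 1))"
  show "\<exists>\<delta>>0. \<forall>D. finite D \<and> (\<forall>(u, v)\<in>D. u \<in> A \<and> v \<in> A \<and> u < v) \<and> disjoint_family_on (\<lambda>(u, v). {u<..<v}) D
       \<and> (\<Sum>(u, v)\<in>D. v - u) < \<delta> \<longrightarrow> (\<Sum>(u, v)\<in>D. \<bar>F v - F u\<bar>) < \<epsilon>"
  proof (intro exI[of _ \<delta>] conjI allI impI, goal_cases)
    case 1 show ?case using \<open>\<epsilon> > 0\<close> by (simp add: \<delta>_def)
  next
    case (2 D)
    then have D: "finite D" "\<And>u v. (u, v) \<in> D \<Longrightarrow> u \<in> A \<and> v \<in> A \<and> u < v"
      and disj: "disjoint_family_on (\<lambda>(u, v). {u<..<v}) D" and sum: "(\<Sum>(u, v)\<in>D. v - u) < \<delta>" by auto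
    let ?I = "\<lambda>(u, v). {u<..<v::real}"
    have gI: "set_integrable lborel B (g (real N))" if "B \<in> sets borel" for B
      using integrable_mult_indicator[of B lborel "g (real N)"] that gint[of N] by (simp add: set_integrable_def)
    have incr: "\<bar>F v - F u\<bar> \<le> (LINT r:{u<..<v}|lborel. g (real N) r) + real N * (v - u)" if "(u, v) \<in> D" for u v
    proof -
      have uv: "{u<..<v} \<subseteq> S" "F v - F u = (LINT r:{u<..<v}|lborel. f r)" "u < v" using D(2)[OF that] F by auto
      have const: "set_integrable lborel {u<..<v} (\<lambda>_. real N)" "(LINT r:{u<..<v}|lborel. real N) = real N * (v - u)"
        using uv(3) by (auto simp: set_integrable_def set_lebesgue_integral_def)
      have "\<bar>F v - F u\<bar> \<le> (LINT r|lborel. \<bar>indicator {u<..<v} r *\<^sub>R f r\<bar>)"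
        unfolding uv(2) set_lebesgue_integral_def by (rule integral_abs_bound)
      also have "\<dots> \<le> (LINT r|lborel. indicator {u<..<v} r *\<^sub>R (g (real N) r + real N))"
      proof (rule integral_mono)
        have "set_integrable lborel {u<..<v} f" by (rule set_integrable_subset[OF f _ uv(1)]) auto
        then show "integrable lborel (\<lambda>r. \<bar>indicator {u<..<v} r *\<^sub>R f r\<bar>)" 
          unfolding set_integrable_def by (rule integrable_abs)
        show "integrable lborel (\<lambda>r. indicator {u<..<v} r *\<^sub>R (g (real N) r + real N))"
          using set_integral_add(1)[OF gI[of "{u<..<v}"] const(1)] by (simp add: set_integrable_def)
        show "\<bar>indicator {u<..<v} r *\<^sub>R f r\<bar> \<le> indicator {u<..<v} r *\<^sub>R (g (real N) r + real N)" for r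
          using uv(1) by (auto simp: g_def h_def indicator_def)
      qed
      also have "\<dots> = (LINT r:{u<..<v}|lborel. g (real N) r) + real N * (v - u)"
        using set_integral_add(2)[OF gI[of "{u<..<v}"] const(1)] const(2) by (simp add: set_lebesgue_integral_def)
      finally show ?thesis .
    qed
    have "(\<Sum>(u, v)\<in>D. \<bar>F v - F u\<bar>) \<le> (\<Sum>(u, v)\<in>D. (LINT r:{u<..<v}|lborel. g (real N) r) + real N * (v - u))"
      by (intro sum_mono) (auto intro: incr)
    also have "\<dots> = (\<Sum>d\<in>D. LINT r:?I d|lborel. g (real N) r) + real N * (\<Sum>(u, v)\<in>D. v - u)"
      by (simp add: sum.distrib sum_distrib_left case_prod_unfold)
    also have "(\<Sum>d\<in>D. LINT r:?I d|lborel. g (real N) r) = (LINT r:(\<Union>d\<in>D. ?I d)|lborel. g (real N) r)"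
      by (rule set_integral_finite_Union[symmetric, OF D(1) disj]) (auto intro: gI)
    also have "\<dots> \<le> (LINT r|lborel. g (real N) r)"
      unfolding set_lebesgue_integral_def
    proof (rule integral_mono)
      have "(\<Union>d\<in>D. ?I d) \<in> sets borel" using D(1) by (intro sets.finite_UN) auto
      from gI[OF this] show "integrable lborel (\<lambda>r. indicator (\<Union>d\<in>D. ?I d) r *\<^sub>R g (real N) r)" by (simp add: set_integrable_def)
    qed (use gint g0 in \<open>auto simp: indicator_def\<close>)
    also note N
    also have "real N * (\<Sum>(u, v)\<in>D. v - u) \<le> (real N + 1) * \<delta>"
      using sum \<open>\<epsilon> > 0\<close> by (intro mult_mono) (auto simp: \<delta>_def intro!: sum_nonneg dest: D(2))
    also have "(real N + 1) * \<delta> = \<epsilon> / 2" by (simp add: \<delta>_def field_simps)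
    finally show ?case by simp
  qed
qed

lemma integral_increment:
  fixes f :: "real \<Rightarrow> real"
  assumes f: "set_integrable lborel {a<..<v} f" and "a < u" "u < v"
  shows "(LINT r:{a<..<v}|lborel. f r) - (LINT r:{a<..<u}|lborel. f r) = (LINT r:{u<..<v}|lborel. f r)"
proof -
  have "set_integrable lborel {a<..<u} f" "set_integrable lborel {u<..<v} f"
    using assms by (auto intro: set_integrable_subset[OF f])
  then have "(LINT r:{a<..<u} \<union> {u<..<v}|lborel. f r) = (LINT r:{a<..<u}|lborel. f r) + (LINT r:{u<..<v}|lborel. f r)"
    by (intro set_integral_Un) auto
  moreover have "(LINT r:{a<..<u} \<union> {u<..<v}|lborel. f r) = (LINT r:{a<..<v}|lborel. f r)"
  proof (rule set_integral_cong_set)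
    show "set_borel_measurable lborel {a<..<v} f" using f by (simp add: set_borel_measurable_def set_integrable_def borel_measurable_integrable)
    then show "set_borel_measurable lborel ({a<..<u} \<union> {u<..<v}) f"
      by (rule set_borel_measurable_subset) (use assms in auto)
    show "AE x in lborel. (x \<in> {a<..<v}) = (x \<in> {a<..<u} \<union> {u<..<v})"
      using AE_lborel_singleton[of u] by eventually_elim (use assms in auto)
  qed
  ultimately show ?thesis by simp
qed

text \<open>The integrand may be singular at the left end point $a$; the integral is therefore split at
  a point between $a$ and $t$, and the fundamental theorem is applied to the right piece.\<close>
lemma integral_has_derivative_interior:
  fixes f :: "real \<Rightarrow> real"
  assumes f: "\<And>t. a < t \<Longrightarrow> set_integrable lborel {a<..<t} f" and cont: "continuous_on {a<..} f" and "a < t"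
  shows "((\<lambda>t. LINT r:{a<..<t}|lborel. f r) has_real_derivative f t) (at t)"
proof -
  define c where "c = (a + t) / 2"
  have c: "a < c" "c < t" using \<open>a < t\<close> by (auto simp: c_def)
  have "((\<lambda>x. integral {c..x} f) has_real_derivative f t) (at t within {c..t+1})"
    using c by (intro integral_has_real_derivative continuous_on_subset[OF cont]) auto
  then have "((\<lambda>x. integral {c..x} f) has_real_derivative f t) (at t)"
    using c by (subst (asm) at_within_interior) auto
  then have *: "((\<lambda>x. (LINT r:{a<..<c}|lborel. f r) + integral {c..x} f) has_real_derivative f t) (at t)"
    by (auto intro!: derivative_eq_intros)
  show ?thesis
  proof (rule has_field_derivative_transform_within_open[OF *, of "{c<..}"])
    fix x assume "x \<in> {c<..}"
    then have x: "c < x" "a < x" using c by auto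
    have "set_integrable lborel {c<..<x} f" using c by (intro set_integrable_subset[OF f[OF x(2)]]) auto
    from set_borel_integral_eq_integral(2)[OF this] 
    show "(LINT r:{a<..<c}|lborel. f r) + integral {c..x} f = (LINT r:{a<..<x}|lborel. f r)"
      using integral_increment[OF f[OF x(2)] c(1) x(1)] by (simp add: integral_open_interval_real)
  qed (use c in auto)
qed

section \<open>Composing fractional integrals of complementary order\<close>

context abel begin

text \<open>The substitution $s = r + (t-r)v$ gives the Beta integral $B(\beta, 1-\beta)$; the value
  does not depend on $r$ and $t$ because the two exponents add up to $-1$. This is the reason why $I^{1-\beta}$ undoes
  $I^\beta$ up to an ordinary integral.\<close>
lemma nn_integral_abel_kernel:
  assumes "r < t"
  shows "(\<integral>\<^sup>+s. ennreal (indicator {r<..<t} s * ((t - s) powr (-\<beta>) * (s - r) powr (\<beta> - 1))) \<partial>lborel)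
    = ennreal (Gamma \<beta> * Gamma (1 - \<beta>))"
proof -
  let ?f = "\<lambda>s. indicator {r<..<t} s * ((t - s) powr (-\<beta>) * (s - r) powr (\<beta> - 1))"
  have "(\<integral>\<^sup>+s. ennreal (?f s) \<partial>lborel) = ennreal \<bar>t - r\<bar> * (\<integral>\<^sup>+v. ennreal (?f (r + (t - r) * v)) \<partial>lborel)"
    using assms by (intro nn_integral_real_affine) auto
  also have "\<dots> = (\<integral>\<^sup>+v. ennreal (t - r) * ennreal (?f (r + (t - r) * v)) \<partial>lborel)"
    using assms by (subst nn_integral_cmult) auto
  also have "\<dots> = (\<integral>\<^sup>+v. ennreal (indicator {0<..<1} v * (v powr (\<beta> - 1) * (1 - v) powr ((1 - \<beta>) - 1))) \<partial>lborel)"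
  proof (intro nn_integral_cong)
    fix v
    have "(t - r) * ?f (r + (t - r) * v) = indicator {0<..<1} v * (v powr (\<beta> - 1) * (1 - v) powr ((1 - \<beta>) - 1))"
    proof (cases "v \<in> {0<..<1}")
      case True
      have 1: "t - (r + (t - r) * v) = (t - r) * (1 - v)" by (simp add: algebra_simps)
      have 2: "r + (t - r) * v \<in> {r<..<t}" using True assms 1
        by (smt (verit) greaterThanLessThan_iff mult_pos_pos)
      have "(t - r) * ((t - r) powr (-\<beta>) * (t - r) powr (\<beta> - 1)) = 1"
        using assms powr_add[of "t - r" "-\<beta>" "\<beta> - 1"] by (simp add: powr_minus_divide field_simps)
      moreover have "?f (r + (t - r) * v) = ((t - r) powr (-\<beta>) * (1 - v) powr (-\<beta>)) * ((t - r) powr (\<beta> - 1) * v powr (\<beta> - 1))"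
        using True assms 2 unfolding 1 by (simp add: powr_mult)
      ultimately have "(t - r) * ?f (r + (t - r) * v) = (1 - v) powr (-\<beta>) * v powr (\<beta> - 1)"
        by algebra
      then show ?thesis using True by (simp add: mult.commute)
    next
      case False
      have "r + (t - r) * v \<notin> {r<..<t}"
      proof
        assume "r + (t - r) * v \<in> {r<..<t}"
        then have "0 < (t - r) * v" "0 < (t - r) * (1 - v)" by (auto simp: algebra_simps)
        then show False using assms False by (auto simp: zero_less_mult_iff)
      qed
      then show ?thesis using False by simp
    qed
    then show "ennreal (t - r) * ennreal (?f (r + (t - r) * v)) = ennreal (indicator {0<..<1} v * (v powr (\<beta> - 1) * (1 - v) powr ((1 - \<beta>) - 1)))"
      using assms by (simp flip: ennreal_mult)
  qed
  also have "\<dots> = ennreal (Beta \<beta> (1 - \<beta>))" by (rule nn_integral_Beta) (use beta in auto)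
  finally show ?thesis by (simp add: Beta_def)
qed

text \<open>Tonelli's theorem moves the integration over $s$ inside, where \<open>nn_integral_abel_kernel\<close> evaluates it.\<close>
lemma nn_integral_abel_compose:
  assumes [measurable]: "f \<in> borel_measurable borel"
  shows "(\<integral>\<^sup>+s. ennreal (indicator {0<..<t} s * (t - s) powr (-\<beta>)) *
            (\<integral>\<^sup>+r. ennreal (indicator {0<..<s} r * (s - r) powr (\<beta> - 1)) * f r \<partial>lborel) \<partial>lborel)
    = ennreal (Gamma \<beta> * Gamma (1 - \<beta>)) * (\<integral>\<^sup>+r. indicator {0<..<t} r * f r \<partial>lborel)"
proof -
  define k where "k s r = ennreal (if 0 < r \<and> r < s \<and> s < t then (t - s) powr (-\<beta>) * (s - r) powr (\<beta> - 1) else 0) * f r" for s r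
  have [measurable]: "case_prod k \<in> borel_measurable (lborel \<Otimes>\<^sub>M lborel)"
    unfolding k_def[abs_def] by measurable
  have "(\<integral>\<^sup>+s. ennreal (indicator {0<..<t} s * (t - s) powr (-\<beta>)) *
            (\<integral>\<^sup>+r. ennreal (indicator {0<..<s} r * (s - r) powr (\<beta> - 1)) * f r \<partial>lborel) \<partial>lborel)
     = (\<integral>\<^sup>+s. (\<integral>\<^sup>+r. k s r \<partial>lborel) \<partial>lborel)"
  proof (intro nn_integral_cong, subst nn_integral_cmult[symmetric])
    fix s
    show "(\<integral>\<^sup>+r. ennreal (indicator {0<..<t} s * (t - s) powr (-\<beta>)) * (ennreal (indicator {0<..<s} r * (s - r) powr (\<beta> - 1)) * f r) \<partial>lborel)
      = (\<integral>\<^sup>+r. k s r \<partial>lborel)"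
      by (intro nn_integral_cong) (auto simp: k_def indicator_def ennreal_mult mult.assoc)
  qed measurable
  also have "\<dots> = (\<integral>\<^sup>+r. (\<integral>\<^sup>+s. k s r \<partial>lborel) \<partial>lborel)"
    by (rule lborel_pair.Fubini'[symmetric]) measurable
  also have "\<dots> = (\<integral>\<^sup>+r. ennreal (Gamma \<beta> * Gamma (1 - \<beta>)) * (indicator {0<..<t} r * f r) \<partial>lborel)"
  proof (rule nn_integral_cong)
    fix r
    show "(\<integral>\<^sup>+s. k s r \<partial>lborel) = ennreal (Gamma \<beta> * Gamma (1 - \<beta>)) * (indicator {0<..<t} r * f r)"
    proof (cases "0 < r \<and> r < t")
      case True
      have "(\<integral>\<^sup>+s. k s r \<partial>lborel) = (\<integral>\<^sup>+s. ennreal (indicator {r<..<t} s * ((t - s) powr (-\<beta>) * (s - r) powr (\<beta> - 1))) * f r \<partial>lborel)"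
        using True by (intro nn_integral_cong) (auto simp: k_def indicator_def)
      also have "\<dots> = ennreal (Gamma \<beta> * Gamma (1 - \<beta>)) * f r"
        using True by (subst nn_integral_multc) (auto simp: nn_integral_abel_kernel)
      finally show ?thesis using True by simp
    next
      case False
      then have "k s r = 0" for s by (auto simp: k_def)
      then show ?thesis using False by (auto simp: indicator_def)
    qed
  qed
  also have "\<dots> = ennreal (Gamma \<beta> * Gamma (1 - \<beta>)) * (\<integral>\<^sup>+r. indicator {0<..<t} r * f r \<partial>lborel)"
    by (rule nn_integral_cmult) measurable
  finally show ?thesis .
qed

lemma weighted_profile_measurable:
  assumes "profile e C G"
  shows "(\<lambda>r. indicator {0<..} r * (r powr (-\<beta>) * G r)) \<in> borel_measurable borel"
proof -
  have "(\<lambda>r. r powr (-\<beta>) * (indicator {0<..} r * G r)) \<in> borel_measurable borel"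
    using assms by (intro borel_measurable_times antimono_measurable) (auto simp: profile_def)
  then show ?thesis by (simp add: mult_ac)
qed

lemma abel_mean_eq_integral:
  assumes G: "profile e C G" and "0 < t"
  shows "ennreal (Gamma \<beta> * abel_mean \<beta> G t) = (\<integral>\<^sup>+r. ennreal (indicator {0<..<t} r * (t - r) powr (\<beta> - 1))
      * ennreal (indicator {0<..} r * (r powr (-\<beta>) * G r)) \<partial>lborel)"
proof -
  note [measurable] = weighted_profile_measurable[OF G]
  let ?f = "\<lambda>r. ennreal (indicator {0<..<t} r * (t - r) powr (\<beta> - 1)) * ennreal (indicator {0<..} r * (r powr (-\<beta>) * G r))"
  have "(\<integral>\<^sup>+r. ?f r \<partial>lborel) = ennreal \<bar>t\<bar> * (\<integral>\<^sup>+u. ?f (0 + t * u) \<partial>lborel)"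
    using assms by (intro nn_integral_real_affine) auto
  also have "\<dots> = (\<integral>\<^sup>+u. ennreal t * ?f (t * u) \<partial>lborel)"
    using assms by (subst nn_integral_cmult) auto
  also have "\<dots> = (\<integral>\<^sup>+u. ennreal (kern \<beta> u * G (t * u)) \<partial>lborel)"
  proof (intro nn_integral_cong)
    fix u
    show "ennreal t * ?f (t * u) = ennreal (kern \<beta> u * G (t * u))"
    proof (cases "u \<in> {0<..<1}")
      case True
      have 1: "t - t * u = t * (1 - u)" by (simp add: algebra_simps)
      have 2: "0 < t * u" "t * u < t" using True \<open>0 < t\<close> by auto
      have "t * (t powr (\<beta> - 1) * t powr (-\<beta>)) = 1"
        using \<open>0 < t\<close> powr_add[of t "\<beta> - 1" "-\<beta>"] by (simp add: powr_minus_divide field_simps)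
      then have "t * ((t - t * u) powr (\<beta> - 1) * ((t * u) powr (-\<beta>) * G (t * u))) = kern \<beta> u * G (t * u)"
        using True \<open>0 < t\<close> by (simp add: 1 powr_mult kern_def mult_ac)
      moreover have "ennreal t * ?f (t * u) = ennreal (t * ((t - t * u) powr (\<beta> - 1) * ((t * u) powr (-\<beta>) * G (t * u))))"
        using 2 \<open>0 < t\<close> G by (simp add: profile_def flip: ennreal_mult)
      ultimately show ?thesis by (simp only:)
    next
      case False
      then have "t * u \<notin> {0<..<t}" using \<open>0 < t\<close> by (auto simp: zero_less_mult_iff)
      then show ?thesis using False by (simp add: kern_def)
    qed
  qed
  also have "\<dots> = ennreal (LINT u|lborel. kern \<beta> u * G (t * u))"
    by (intro nn_integral_eq_integral profile_integrable[OF G] \<open>0 < t\<close> AE_I2 kern_le_majorant(1)[OF G])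
  finally show ?thesis using Gamma_beta_pos by (simp add: abel_mean_def)
qed

text \<open>On $(0,t)$ the factor $(t-s)^{\beta-1}$ is at least $t^{\beta-1}$, so the finite mean at $t$ bounds the
  integral.\<close>
lemma weighted_profile_integrable:
  assumes G: "profile e C G"
  shows "set_integrable lborel {0<..<t} (\<lambda>r. r powr (-\<beta>) * G r)"
proof (cases "0 < t")
  case True
  let ?f = "\<lambda>r. indicator {0<..} r * (r powr (-\<beta>) * G r)"
  note [measurable] = weighted_profile_measurable[OF G]
  have f0: "0 \<le> ?f r" for r using G by (auto simp: profile_def indicator_def)
  have "(\<lambda>r. indicator {0<..<t} r * ?f r) \<in> borel_measurable lborel" by measurable
  moreover have "(\<integral>\<^sup>+r. ennreal (norm (indicator {0<..<t} r * ?f r)) \<partial>lborel) < \<infinity>"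
  proof -
    have "(\<integral>\<^sup>+r. ennreal (norm (indicator {0<..<t} r * ?f r)) \<partial>lborel)
        \<le> (\<integral>\<^sup>+r. ennreal (t powr (1 - \<beta>)) * (ennreal (indicator {0<..<t} r * (t - r) powr (\<beta> - 1)) * ennreal (?f r)) \<partial>lborel)"
    proof (rule nn_integral_mono)
      fix r
      have "norm (indicator {0<..<t} r * ?f r) \<le> t powr (1 - \<beta>) * (indicator {0<..<t} r * (t - r) powr (\<beta> - 1) * ?f r)"
      proof (cases "r \<in> {0<..<t}")
        case True
        have "1 = t powr (1 - \<beta>) * t powr (\<beta> - 1)" using \<open>0 < t\<close> by (simp add: powr_add[symmetric])
        also have "\<dots> \<le> t powr (1 - \<beta>) * (t - r) powr (\<beta> - 1)"
          using True beta by (intro mult_left_mono powr_mono2') auto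
        finally have "1 * ?f r \<le> t powr (1 - \<beta>) * (t - r) powr (\<beta> - 1) * ?f r"
          using f0 by (intro mult_right_mono)
        then show ?thesis using True f0[of r] by (simp add: mult_ac)
      qed simp
      then show "ennreal (norm (indicator {0<..<t} r * ?f r)) \<le> ennreal (t powr (1 - \<beta>)) * (ennreal (indicator {0<..<t} r * (t - r) powr (\<beta> - 1)) * ennreal (?f r))"
        using f0[of r] by (simp flip: ennreal_mult)
    qed
    also have "\<dots> = ennreal (t powr (1 - \<beta>)) * ennreal (Gamma \<beta> * abel_mean \<beta> G t)"
      by (subst nn_integral_cmult) (simp_all add: abel_mean_eq_integral[OF G True])
    also have "\<dots> < \<infinity>" by (simp add: ennreal_mult_less_top)
    finally show ?thesis .
  qed
  ultimately have "integrable lborel (\<lambda>r. indicator {0<..<t} r * ?f r)" by (rule integrableI_bounded)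
  also have "(\<lambda>r. indicator {0<..<t} r * ?f r) = (\<lambda>r. indicator {0<..<t} r *\<^sub>R (r powr (-\<beta>) * G r))"
    by (auto simp: indicator_def)
  finally show ?thesis by (simp add: set_integrable_def)
qed (simp add: set_integrable_def)

text \<open>Both parts of $x$ are integrated with the same kernel evaluation: $t^{\beta-1}$ is the case $r = 0$ of
  \<open>nn_integral_abel_kernel\<close>, and the mean is a fractional integral to which \<open>nn_integral_abel_compose\<close> applies.\<close>
lemma rl_integral_abel:
  assumes G: "profile e C G" and "0 \<le> x0" "0 < t"
    and x: "\<And>s. 0 < s \<Longrightarrow> x s = x0 * s powr (\<beta> - 1) + abel_mean \<beta> G s"
  shows "has_bochner_integral lborel (\<lambda>s. indicator {0<..<t} s *\<^sub>R rl_integrand (1 - \<beta>) x t s)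
    (Gamma (1 - \<beta>) * (Gamma \<beta> * x0 + (LINT r:{0<..<t}|lborel. r powr (-\<beta>) * G r)))"
proof (rule has_bochner_integral_nn_integral)
  let ?f = "\<lambda>r. r powr (-\<beta>) * G r"
  let ?x = "\<lambda>s. x0 * s powr (\<beta> - 1) + indicator {0<..} s * abel_mean \<beta> G s"
  have [measurable]: "(\<lambda>s. indicator {0<..} s * abel_mean \<beta> G s) \<in> borel_measurable borel"
    by (intro antimono_measurable) (auto simp: monotone_on_def intro: abel_mean_antimono[OF G])
  note [measurable] = weighted_profile_measurable[OF G]
  have eq: "indicator {0<..<t} s *\<^sub>R rl_integrand (1 - \<beta>) x t s = indicator {0<..<t} s * ((t - s) powr (-\<beta>) * ?x s)" for s
    by (auto simp: indicator_def rl_integrand_def x)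
  have m0: "0 \<le> indicator {0<..} s * abel_mean \<beta> G s" for s
    by (auto simp: indicator_def intro: abel_mean_nonneg[OF G])
  have x0: "0 \<le> ?x s" for s using m0[of s] \<open>0 \<le> x0\<close> by simp
  show "(\<lambda>s. indicator {0<..<t} s *\<^sub>R rl_integrand (1 - \<beta>) x t s) \<in> borel_measurable lborel"
    unfolding eq by measurable
  show "AE s in lborel. 0 \<le> indicator {0<..<t} s *\<^sub>R rl_integrand (1 - \<beta>) x t s"
    unfolding eq using x0 by (intro AE_I2 mult_nonneg_nonneg) auto
  have F: "(\<integral>\<^sup>+r. indicator {0<..<t} r * ennreal (indicator {0<..} r * ?f r) \<partial>lborel) = ennreal (LINT r:{0<..<t}|lborel. ?f r)"
  proof -
    have "(\<integral>\<^sup>+r. indicator {0<..<t} r * ennreal (indicator {0<..} r * ?f r) \<partial>lborel) = (\<integral>\<^sup>+r. ennreal (indicator {0<..<t} r *\<^sub>R ?f r) \<partial>lborel)"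
      by (intro nn_integral_cong) (auto simp: indicator_def)
    also have "\<dots> = ennreal (LINT r:{0<..<t}|lborel. ?f r)"
      unfolding set_lebesgue_integral_def
      by (intro nn_integral_eq_integral weighted_profile_integrable[OF G, unfolded set_integrable_def] AE_I2)
        (use G in \<open>auto simp: indicator_def profile_def\<close>)
    finally show ?thesis .
  qed
  have F0: "0 \<le> (LINT r:{0<..<t}|lborel. ?f r)"
    unfolding set_lebesgue_integral_def
    by (intro Bochner_Integration.integral_nonneg) (use G in \<open>auto simp: indicator_def profile_def\<close>)
  then show "0 \<le> Gamma (1 - \<beta>) * (Gamma \<beta> * x0 + (LINT r:{0<..<t}|lborel. ?f r))"
    using Gamma_beta_pos \<open>0 \<le> x0\<close> by simp
  have "(\<integral>\<^sup>+s. ennreal (indicator {0<..<t} s *\<^sub>R rl_integrand (1 - \<beta>) x t s) \<partial>lborel)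
    = (\<integral>\<^sup>+s. ennreal x0 * ennreal (indicator {0<..<t} s * ((t - s) powr (-\<beta>) * (s - 0) powr (\<beta> - 1)))
        + ennreal (1 / Gamma \<beta>) * (ennreal (indicator {0<..<t} s * (t - s) powr (-\<beta>)) *
            (\<integral>\<^sup>+r. ennreal (indicator {0<..<s} r * (s - r) powr (\<beta> - 1)) * ennreal (indicator {0<..} r * ?f r) \<partial>lborel)) \<partial>lborel)"
  proof (rule nn_integral_cong)
    fix s
    show "ennreal (indicator {0<..<t} s *\<^sub>R rl_integrand (1 - \<beta>) x t s)
      = ennreal x0 * ennreal (indicator {0<..<t} s * ((t - s) powr (-\<beta>) * (s - 0) powr (\<beta> - 1)))
        + ennreal (1 / Gamma \<beta>) * (ennreal (indicator {0<..<t} s * (t - s) powr (-\<beta>)) *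
            (\<integral>\<^sup>+r. ennreal (indicator {0<..<s} r * (s - r) powr (\<beta> - 1)) * ennreal (indicator {0<..} r * ?f r) \<partial>lborel))"
    proof (cases "s \<in> {0<..<t}")
      case True
      then have "0 < s" by simp
      show ?thesis
        using True \<open>0 \<le> x0\<close> Gamma_beta_pos abel_mean_nonneg[OF G \<open>0 < s\<close>]
        unfolding abel_mean_eq_integral[OF G \<open>0 < s\<close>, symmetric] eq
        by (simp add: ring_distribs mult_ac flip: ennreal_mult ennreal_plus)
    qed simp
  qed
  also have "\<dots> = ennreal x0 * (\<integral>\<^sup>+s. ennreal (indicator {0<..<t} s * ((t - s) powr (-\<beta>) * (s - 0) powr (\<beta> - 1))) \<partial>lborel)
     + ennreal (1 / Gamma \<beta>) * (\<integral>\<^sup>+s. ennreal (indicator {0<..<t} s * (t - s) powr (-\<beta>)) *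
            (\<integral>\<^sup>+r. ennreal (indicator {0<..<s} r * (s - r) powr (\<beta> - 1)) * ennreal (indicator {0<..} r * ?f r) \<partial>lborel) \<partial>lborel)"
  proof -
    have "(\<lambda>(s, r). ennreal (if 0 < r \<and> r < s then (s - r) powr (\<beta> - 1) else 0) * ennreal (indicator {0<..} r * ?f r)) \<in> borel_measurable (lborel \<Otimes>\<^sub>M lborel)"
      by measurable
    then have "(\<lambda>s. \<integral>\<^sup>+r. ennreal (if 0 < r \<and> r < s then (s - r) powr (\<beta> - 1) else 0) * ennreal (indicator {0<..} r * ?f r) \<partial>lborel) \<in> borel_measurable lborel"
      by (intro lborel.borel_measurable_nn_integral) 
    also have "(\<lambda>s. \<integral>\<^sup>+r. ennreal (if 0 < r \<and> r < s then (s - r) powr (\<beta> - 1) else 0) * ennreal (indicator {0<..} r * ?f r) \<partial>lborel)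
       = (\<lambda>s. \<integral>\<^sup>+r. ennreal (indicator {0<..<s} r * (s - r) powr (\<beta> - 1)) * ennreal (indicator {0<..} r * ?f r) \<partial>lborel)"
      by (intro ext nn_integral_cong) (auto simp: indicator_def)
    finally have [measurable]: "(\<lambda>s. \<integral>\<^sup>+r. ennreal (indicator {0<..<s} r * (s - r) powr (\<beta> - 1)) * ennreal (indicator {0<..} r * ?f r) \<partial>lborel) \<in> borel_measurable borel"
      by simp
    show ?thesis by (subst nn_integral_add) (auto simp: nn_integral_cmult)
  qed
  also have "\<dots> = ennreal x0 * ennreal (Gamma \<beta> * Gamma (1 - \<beta>))
      + ennreal (1 / Gamma \<beta>) * (ennreal (Gamma \<beta> * Gamma (1 - \<beta>)) * ennreal (LINT r:{0<..<t}|lborel. ?f r))"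
    by (subst nn_integral_abel_kernel[OF \<open>0 < t\<close>], subst nn_integral_abel_compose) (simp_all add: F)
  also have "\<dots> = ennreal (Gamma (1 - \<beta>) * (Gamma \<beta> * x0 + (LINT r:{0<..<t}|lborel. ?f r)))"
    using Gamma_beta_pos \<open>0 \<le> x0\<close> F0 by (simp add: ring_distribs mult_ac flip: ennreal_mult ennreal_plus)
  finally show "(\<integral>\<^sup>+s. ennreal (indicator {0<..<t} s *\<^sub>R rl_integrand (1 - \<beta>) x t s) \<partial>lborel)
    = ennreal (Gamma (1 - \<beta>) * (Gamma \<beta> * x0 + (LINT r:{0<..<t}|lborel. ?f r)))" .
qed

lemma abel_has_rl_derivative:
  assumes G: "profile e C G" and cont: "continuous_on {0<..} G" and "0 \<le> x0"
    and x: "\<And>s. 0 < s \<Longrightarrow> x s = x0 * s powr (\<beta> - 1) + abel_mean \<beta> G s"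
  shows "has_rl_derivative \<beta> x (\<lambda>t. t powr (-\<beta>) * G t)"
proof -
  define F where "F t = (LINT r:{0<..<t}|lborel. r powr (-\<beta>) * G r)" for t
  have to_lebesgue: "has_bochner_integral lebesgue g c" if "has_bochner_integral lborel g c" for g :: "real \<Rightarrow> real" and c
  proof -
    have "g \<in> borel_measurable lborel" using that by (auto simp: has_bochner_integral_iff)
    from integrable_completion[OF this] integral_completion[OF this] show ?thesis
      using that unfolding has_bochner_integral_iff by simp
  qed
  have bochner: "has_bochner_integral lebesgue (\<lambda>s. indicator {0<..<t} s *\<^sub>R rl_integrand (1 - \<beta>) x t s)
    (Gamma (1 - \<beta>) * (Gamma \<beta> * x0 + F t))" if "0 < t" for t
    unfolding F_def by (intro to_lebesgue rl_integral_abel[OF G \<open>0 \<le> x0\<close> that x])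
  have rl: "rl_integral (1 - \<beta>) x t = Gamma \<beta> * x0 + F t" if "0 < t" for t
    using has_bochner_integral_integral_eq[OF bochner[OF that]] Gamma_beta_pos
    by (simp add: rl_integral_def set_lebesgue_integral_def)
  show ?thesis
    unfolding has_rl_derivative_def
  proof (intro conjI allI impI)
    fix t :: real assume "0 < t"
    show "set_integrable lebesgue {0<..<t} (rl_integrand (1 - \<beta>) x t)"
      unfolding set_integrable_def using bochner[OF \<open>0 < t\<close>] by (rule integrable.intros)
    show "abs_cont_on {0<..t} (rl_integral (1 - \<beta>) x)"
    proof (rule abs_cont_on_integral[OF weighted_profile_integrable[OF G]])
      fix u v assume "u \<in> {0<..t}" "v \<in> {0<..t}" "u < v"
      then show "{u<..<v} \<subseteq> {0<..<t} \<and> rl_integral (1 - \<beta>) x v - rl_integral (1 - \<beta>) x u = (LINT r:{u<..<v}|lborel. r powr (-\<beta>) * G r)"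
        using integral_increment[OF weighted_profile_integrable[OF G, of v], of u] by (auto simp: rl F_def)
    qed
    have "continuous_on {0<..} (\<lambda>r. r powr (-\<beta>) * G r)"
      by (intro continuous_intros cont) auto
    from integral_has_derivative_interior[OF weighted_profile_integrable[OF G] this \<open>0 < t\<close>]
    have "((\<lambda>t. Gamma \<beta> * x0 + F t) has_real_derivative t powr (-\<beta>) * G t) (at t)"
      unfolding F_def by (auto intro!: derivative_eq_intros)
    then show "(rl_integral (1 - \<beta>) x has_real_derivative t powr (-\<beta>) * G t) (at t)"
      by (rule has_field_derivative_transform_within_open[of _ _ _ "{0<..}"]) (use \<open>0 < t\<close> rl in auto)
  qed
qed

end

section \<open>A priori bounds and monotone iteration\<close>

text \<open>Write $h(t) = t^d w(t)$ and $r = d - \beta$. On $[s/2, s]$ the nonincreasing function $t^\beta w$ is at least its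
  value at $s$, and $t^r$ is comparable to $s^r$; so $h$ is there at least a fixed multiple of $h(s)$. Hence
  $s\,h(s)^p$ is bounded by a multiple of the integral of $h^p$ over $[0,1]$.\<close>
lemma Lp_imp_pointwise_bound:
  fixes w :: "real \<Rightarrow> real"
  assumes "p > 0" and nonneg: "\<forall>t>0. 0 \<le> t powr \<beta> * w t" and anti: "antimono_on {0<..} (\<lambda>t. t powr \<beta> * w t)"
    and Lp: "in_Lp p {0..1} (\<lambda>t. t powr d * w t)"
  obtains C where "0 \<le> C" "\<And>s. 0 < s \<Longrightarrow> s \<le> 1 \<Longrightarrow> s powr \<beta> * w s \<le> C * s powr (\<beta> - d - 1 / p)"
proof -
  define r where "r = d - \<beta>"
  define I where "I = (LINT u:{0..1}|lebesgue. \<bar>u powr d * w u\<bar> powr p)"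
  have int: "set_integrable lebesgue {0..1} (\<lambda>u. \<bar>u powr d * w u\<bar> powr p)"
    using Lp by (simp add: in_Lp_def)
  have "0 \<le> I" unfolding I_def set_lebesgue_integral_def by (intro Bochner_Integration.integral_nonneg) auto
  have "s powr \<beta> * w s \<le> 2 powr \<bar>r\<bar> * (2 * I) powr (1 / p) * s powr (\<beta> - d - 1 / p)" if s: "0 < s" "s \<le> 1" for s
  proof -
    define L where "L = s powr \<beta> * w s"
    define q where "q = s powr r * 2 powr (-\<bar>r\<bar>) * L"
    have "0 \<le> L" using nonneg s by (simp add: L_def)
    then have "0 \<le> q" by (simp add: q_def)
    have q: "q \<le> \<bar>u powr d * w u\<bar>" if u: "s / 2 \<le> u" "u \<le> s" for u
    proof -
      have "0 < u" using u s by simp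
      have "2 powr (-\<bar>r\<bar>) \<le> (u / s) powr r"
      proof (cases "0 \<le> r")
        case True
        have "2 powr (-\<bar>r\<bar>) = (1 / 2) powr r" using True by (simp add: powr_minus_divide powr_divide)
        also have "\<dots> \<le> (u / s) powr r" using True u s by (intro powr_mono2) (auto simp: field_simps)
        finally show ?thesis .
      next
        case False
        have "2 powr (-\<bar>r\<bar>) \<le> (2::real) powr 0" by (intro powr_mono) auto
        also have "\<dots> = 1 powr r" by simp
        also have "\<dots> \<le> (u / s) powr r" using False u s \<open>0 < u\<close> by (intro powr_mono2') (auto simp: field_simps)
        finally show ?thesis .
      qed
      then have "s powr r * 2 powr (-\<bar>r\<bar>) \<le> s powr r * (u / s) powr r" by (intro mult_left_mono) auto
      also have "\<dots> = u powr r" using s \<open>0 < u\<close> by (simp add: powr_divide)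
      finally have "q \<le> u powr r * L" unfolding q_def using \<open>0 \<le> L\<close> by (intro mult_right_mono)
      also have "\<dots> \<le> u powr r * (u powr \<beta> * w u)"
        using anti u s \<open>0 < u\<close> unfolding L_def by (intro mult_left_mono) (auto simp: monotone_on_def)
      also have "\<dots> = u powr d * w u" using \<open>0 < u\<close> by (simp add: r_def powr_diff)
      also have "\<dots> \<le> \<bar>u powr d * w u\<bar>" by simp
      finally show ?thesis .
    qed
    have "s / 2 * q powr p = (LINT u:{s/2..s}|lebesgue. q powr p)"
      using s by (simp add: set_lebesgue_integral_def)
    also have "\<dots> \<le> I"
      unfolding I_def set_lebesgue_integral_def
    proof (rule integral_mono)
      show "indicator {s/2..s} u *\<^sub>R (q powr p) \<le> indicator {0..1} u *\<^sub>R (\<bar>u powr d * w u\<bar> powr p)" for u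
        using q[of u] \<open>0 \<le> q\<close> s \<open>p > 0\<close> by (auto simp: indicator_def intro: powr_mono2)
    qed (use int s in \<open>auto simp: set_integrable_def\<close>)
    finally have "q powr p \<le> 2 * I / s" using s by (simp add: field_simps)
    then have "(q powr p) powr (1 / p) \<le> (2 * I / s) powr (1 / p)"
      using \<open>p > 0\<close> by (intro powr_mono2) auto
    then have q_le: "q \<le> (2 * I) powr (1 / p) * s powr (- (1 / p))"
      using \<open>p > 0\<close> \<open>0 \<le> q\<close> \<open>0 \<le> I\<close> s by (simp add: powr_powr powr_divide powr_minus_divide)
    have "L = 2 powr \<bar>r\<bar> * s powr (- r) * q"
      using s by (simp add: q_def powr_minus field_simps)
    also have "\<dots> \<le> 2 powr \<bar>r\<bar> * s powr (- r) * ((2 * I) powr (1 / p) * s powr (- (1 / p)))"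
      using q_le by (intro mult_left_mono) auto
    also have "\<dots> = 2 powr \<bar>r\<bar> * (2 * I) powr (1 / p) * (s powr (- r) * s powr (- (1 / p)))" by (simp add: mult_ac)
    also have "s powr (- r) * s powr (- (1 / p)) = s powr (\<beta> - d - 1 / p)"
      by (simp add: r_def powr_add[symmetric])
    finally show ?thesis by (simp add: L_def)
  qed
  then show thesis using that[of "2 powr \<bar>r\<bar> * (2 * I) powr (1 / p)"] by simp
qed

text \<open>The choice $R^{1-\mu} = A_0 + A_1 + 1$ works, because $A_0 \le A_0 R^\mu$ for $R \ge 1$.\<close>
lemma sublinear_bound_exists:
  fixes A0 A1 \<mu> :: real
  assumes "0 \<le> A0" "0 \<le> A1" "\<mu> < 1" "0 \<le> \<mu>"
  obtains R where "1 \<le> R" "A0 + A1 * R powr \<mu> \<le> R"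
proof
  define R where "R = (A0 + A1 + 1) powr (1 / (1 - \<mu>))"
  show R: "1 \<le> R" unfolding R_def using assms by (intro ge_one_powr_ge_zero) auto
  then have "1 \<le> R powr \<mu>" using assms by (intro ge_one_powr_ge_zero) auto
  then have "A0 * 1 \<le> A0 * R powr \<mu>" using assms(1) by (rule mult_left_mono)
  then have "A0 + A1 * R powr \<mu> \<le> (A0 + A1) * R powr \<mu>" by (simp add: distrib_right)
  also have "\<dots> \<le> (A0 + A1 + 1) * R powr \<mu>" by (intro mult_right_mono) auto
  also have "A0 + A1 + 1 = R powr (1 - \<mu>)" using assms by (simp add: R_def powr_powr)
  also have "R powr (1 - \<mu>) * R powr \<mu> = R" using R by (simp add: powr_add[symmetric])
  finally show "A0 + A1 * R powr \<mu> \<le> R" .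
qed

lemma antimono_tendsto_at_top:
  fixes x :: "real \<Rightarrow> real"
  assumes anti: "antimono_on {0<..} x" and nonneg: "\<And>t. 0 < t \<Longrightarrow> 0 \<le> x t"
  obtains c where "0 \<le> c" "(x \<longlongrightarrow> c) at_top"
proof
  define c where "c = (INF t\<in>{0<..}. x t)"
  have bdd: "bdd_below (x ` {0<..})" using nonneg by (auto intro: bdd_belowI[of _ 0])
  show "0 \<le> c" unfolding c_def using nonneg by (intro cINF_greatest) auto
  show "(x \<longlongrightarrow> c) at_top"
  proof (rule order_tendstoI)
    fix a assume "a < c"
    have lower: "a < x t" if "0 < t" for t
      using \<open>a < c\<close> cINF_lower[OF bdd, of t] that by (simp add: c_def)
    show "\<forall>\<^sub>F t in at_top. a < x t"
      using eventually_gt_at_top[of "0::real"] by eventually_elim (rule lower)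
  next
    fix a assume "c < a"
    then obtain t0 where "0 < t0" "x t0 < a"
      using bdd unfolding c_def by (subst (asm) cINF_less_iff) auto
    show "\<forall>\<^sub>F t in at_top. x t < a"
      using eventually_ge_at_top[of t0]
    proof eventually_elim
      case (elim t)
      then have "x t \<le> x t0" using anti \<open>0 < t0\<close> by (simp add: monotone_on_def)
      then show ?case using \<open>x t0 < a\<close> by simp
    qed
  qed
qed

context abel begin

text \<open>Because $e > \beta - 1$, the bound $t^e$ for the mean is at most $t^{\beta-1}$ on $(0,1]$. So the bound on $R$ makes
  the class of profiles with exponent $\beta-1$ and constant $R$ a candidate for an invariant set.\<close>
lemma solution_operator_profile:
  assumes G: "profile e C G" and "0 \<le> x0" and R: "x0 + C * Beta (1 - \<beta> + e) \<beta> / Gamma \<beta> \<le> R"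
  shows "profile (\<beta> - 1) R (\<lambda>t. x0 * t powr (\<beta> - 1) + abel_mean \<beta> G t)"
  unfolding profile_def
proof (intro conjI allI impI)
  show "antimono_on {0<..} (\<lambda>t. x0 * t powr (\<beta> - 1) + abel_mean \<beta> G t)"
    using beta \<open>0 \<le> x0\<close>
    by (auto simp: monotone_on_def intro!: add_mono mult_left_mono powr_mono2' abel_mean_antimono[OF G])
next
  fix t :: real assume "0 < t"
  then show "0 \<le> x0 * t powr (\<beta> - 1) + abel_mean \<beta> G t"
    using \<open>0 \<le> x0\<close> abel_mean_nonneg[OF G] by simp
next
  fix t :: real assume t: "0 < t \<and> t \<le> 1"
  let ?c = "C * Beta (1 - \<beta> + e) \<beta> / Gamma \<beta>"
  have "0 \<le> ?c"
    using profile_bound(2)[OF G, of 1] Beta_pos[of "1 - \<beta> + e" \<beta>] Gamma_beta_pos beta e by simp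
  then have "?c * t powr e \<le> ?c * t powr (\<beta> - 1)"
    using t e by (intro mult_left_mono powr_mono') auto
  then have "x0 * t powr (\<beta> - 1) + abel_mean \<beta> G t \<le> (x0 + ?c) * t powr (\<beta> - 1)"
    using abel_mean_bound[OF G, of t] t by (simp add: algebra_simps)
  also have "\<dots> \<le> R * t powr (\<beta> - 1)" using R by (intro mult_right_mono) auto
  finally show "x0 * t powr (\<beta> - 1) + abel_mean \<beta> G t \<le> R * t powr (\<beta> - 1)" .
qed

text \<open>The iterates start at $0$, which lies below every profile. The operator preserves order since $f(s,\cdot)$ is nondecreasing,
  so they increase; as they stay in the invariant class, they converge pointwise. All
  properties that define profiles pass to pointwise limits.\<close>
lemma monotone_iteration:
  fixes f :: "real \<Rightarrow> real \<Rightarrow> real"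
  assumes prof: "\<And>x. profile (\<beta> - 1) R x \<Longrightarrow> profile e C (\<lambda>s. f s (x s))"
    and mono: "\<And>s. 0 < s \<Longrightarrow> mono_on {0..} (f s)"
    and cont: "\<And>s. 0 < s \<Longrightarrow> continuous_on {0..} (f s)"
    and "0 \<le> x0" and R: "x0 + C * Beta (1 - \<beta> + e) \<beta> / Gamma \<beta> \<le> R" "0 \<le> R"
  obtains x where "profile (\<beta> - 1) R x"
    "\<And>t. 0 < t \<Longrightarrow> x t = x0 * t powr (\<beta> - 1) + abel_mean \<beta> (\<lambda>s. f s (x s)) t"
proof -
  define T where "T x t = x0 * t powr (\<beta> - 1) + abel_mean \<beta> (\<lambda>s. f s (x s)) t" for x t
  define X where "X n = (T ^^ n) (\<lambda>_. 0)" for n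
  have T: "profile (\<beta> - 1) R (T x)" if "profile (\<beta> - 1) R x" for x
    unfolding T_def[abs_def] using prof[OF that] \<open>0 \<le> x0\<close> R(1) by (rule solution_operator_profile)
  have X: "profile (\<beta> - 1) R (X n)" for n
  proof (induction n)
    case 0 show ?case using \<open>0 \<le> R\<close> by (simp add: X_def profile_def monotone_on_def)
  next
    case (Suc n) then show ?case using T by (simp add: X_def)
  qed
  have X_nonneg: "0 \<le> X n t" if "0 < t" for n t using X[of n] that by (simp add: profile_def)
  have step: "X n t \<le> X (Suc n) t" if "0 < t" for n t using that
  proof (induction n arbitrary: t)
    case 0
    have "X 0 t = 0" by (simp add: X_def)
    then show ?case using X_nonneg[OF 0, of "Suc 0"] by linarith
  next
    case (Suc n)
    have "abel_mean \<beta> (\<lambda>s. f s (X n s)) t \<le> abel_mean \<beta> (\<lambda>s. f s (X (Suc n) s)) t"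
    proof (rule abel_mean_mono[OF prof[OF X] prof[OF X] Suc.prems])
      fix s :: real assume "0 < s"
      then show "f s (X n s) \<le> f s (X (Suc n) s)"
        using Suc.IH[of s] X_nonneg[of s] by (intro mono_onD[OF mono[of s]]) auto
    qed
    then show ?case by (simp add: X_def T_def)
  qed
  have bound: "X n t \<le> (if t \<le> 1 then R * t powr (\<beta> - 1) else R)" if "0 < t" for n t
  proof (cases "t \<le> 1")
    case True then show ?thesis using X[of n] that by (auto simp: profile_def)
  next
    case False
    then have "X n t \<le> X n 1" using X[of n] by (auto simp: profile_def monotone_on_def)
    also have "\<dots> \<le> R" using X[of n] by (auto simp: profile_def dest: spec[of _ 1])
    finally show ?thesis using False by simp
  qed
  define x where "x t = lim (\<lambda>n. X n t)" for t
  have lim: "(\<lambda>n. X n t) \<longlonglongrightarrow> x t" if "0 < t" for t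
  proof -
    have "incseq (\<lambda>n. X n t)" using step[OF that] by (rule incseq_SucI)
    moreover have "Bseq (\<lambda>n. X n t)"
      using bound[OF that] X_nonneg[OF that] by (intro BseqI'[of _ "if t \<le> 1 then R * t powr (\<beta> - 1) else R"]) simp
    ultimately show ?thesis
      unfolding x_def convergent_LIMSEQ_iff[symmetric] by (intro Bseq_monoseq_convergent incseq_imp_monoseq)
  qed
  have x: "profile (\<beta> - 1) R x"
    unfolding profile_def
  proof (intro conjI allI impI)
    show "antimono_on {0<..} x"
    proof (rule monotone_onI)
      fix s t :: real assume st: "s \<in> {0<..}" "t \<in> {0<..}" "s \<le> t"
      then show "x t \<le> x s"
        using X by (intro LIMSEQ_le[OF lim lim]) (auto simp: profile_def monotone_on_def)
    qed
    show "0 \<le> x s" if "0 < s" for s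
      using X_nonneg[OF that] by (intro LIMSEQ_le_const[OF lim[OF that]]) auto
    show "x s \<le> R * s powr (\<beta> - 1)" if "0 < s \<and> s \<le> 1" for s
      using X that by (intro LIMSEQ_le_const2[OF lim]) (auto simp: profile_def)
  qed
  have "x t = x0 * t powr (\<beta> - 1) + abel_mean \<beta> (\<lambda>s. f s (x s)) t" if "0 < t" for t
  proof (rule LIMSEQ_unique)
    show "(\<lambda>n. X (Suc n) t) \<longlonglongrightarrow> x t" using lim[OF that] by (rule LIMSEQ_Suc)
    have "(\<lambda>n. abel_mean \<beta> (\<lambda>s. f s (X n s)) t) \<longlonglongrightarrow> (LINT u|lborel. kern \<beta> u * f (t * u) (x (t * u))) / Gamma \<beta>"
    proof (rule abel_mean_LIMSEQ[of C "\<lambda>n s. f s (X n s)" t "\<lambda>_. t"])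
      show "(\<lambda>u. kern \<beta> u * f (t * u) (x (t * u))) \<in> borel_measurable borel"
        using prof[OF x] that by (intro kern_profile_measurable) (auto simp: profile_def)
      show "AE u in lborel. u \<in> {0<..<1} \<longrightarrow> (\<lambda>n. f (t * u) (X n (t * u))) \<longlonglongrightarrow> f (t * u) (x (t * u))"
      proof (intro AE_I2 impI)
        fix u :: real assume "u \<in> {0<..<1}"
        then have "0 < t * u" using that by simp
        then show "(\<lambda>n. f (t * u) (X n (t * u))) \<longlonglongrightarrow> f (t * u) (x (t * u))"
          using x X_nonneg by (intro continuous_on_tendsto_compose[OF cont lim]) (auto simp: profile_def)
      qed
    qed (use prof[OF X] that in auto)
    then show "(\<lambda>n. X (Suc n) t) \<longlonglongrightarrow> x0 * t powr (\<beta> - 1) + abel_mean \<beta> (\<lambda>s. f s (x s)) t"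
      by (simp add: X_def T_def abel_mean_def tendsto_intros)
  qed
  with x show thesis by (rule that)
qed

end

section \<open>A decreasing solution and its limit\<close>

theorem theorem3p2:
  fixes \<beta> x0 \<mu> p M a b \<kappa> :: real and \<phi> l k :: "real \<Rightarrow> real"
  assumes "0 < \<beta>" "\<beta> < 1" and "x0 > 0" and "0 \<le> \<mu>" "\<mu> < 1" and "p > 1 / \<beta>"
    and "\<forall>t\<ge>0. \<phi> t \<ge> 0" "continuous_on {0..} \<phi>" "mono_on {0..} \<phi>"
    and "M \<ge> 0" "\<forall>t\<ge>0. \<bar>\<phi> t\<bar> \<le> M * rpow t \<mu>"
    and "\<forall>t>0. t powr \<beta> * l t \<ge> 0" "continuous_on {0<..} (\<lambda>t. t powr \<beta> * l t)"
      "antimono_on {0<..} (\<lambda>t. t powr \<beta> * l t)"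
    and "in_Lp p {0..1} (\<lambda>t. t powr ((1 - \<mu>) * (1 - \<beta>)) * l t)"
    and "\<forall>t>0. t powr \<beta> * k t \<ge> 0" "continuous_on {0<..} (\<lambda>t. t powr \<beta> * k t)"
      "antimono_on {0<..} (\<lambda>t. t powr \<beta> * k t)"
    and "in_Lp p {0..1} (\<lambda>t. t powr (1 - \<beta>) * k t)"
    and "((\<lambda>t. t powr \<beta> * l t) \<longlongrightarrow> a) at_top"
    and "((\<lambda>t. t powr \<beta> * k t) \<longlongrightarrow> b) at_top"
    and "\<kappa> \<ge> 0" "\<kappa> = pi / (Gamma \<beta> * sin (\<beta> * pi)) * (a * \<phi> \<kappa> + b)"
    and "\<forall>y\<ge>0. y = pi / (Gamma \<beta> * sin (\<beta> * pi)) * (a * \<phi> y + b) \<longrightarrow> y = \<kappa>"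
  shows "\<exists>x \<in> C_plus (1 - \<beta>). rl_ivp_solution \<beta> l \<phi> k x0 x
           \<and> strict_antimono_on {0<..} x \<and> (x \<longlongrightarrow> \<kappa>) at_top"
proof -
  note phi_nonneg = assms(7) and phi_cont = assms(8) and phi_mono = assms(9) and phi_growth = assms(11)
  note l_nonneg = assms(12) and l_cont = assms(13) and l_anti = assms(14)
  note k_nonneg = assms(16) and k_cont = assms(17) and k_anti = assms(18)
  have "0 < 1 / \<beta>" using assms(1) by simp
  then have "0 < p" using assms(6) by linarith
  then have p: "0 < p" "1 / p < \<beta>" using assms(1,6) by (auto simp: field_simps)
  \<comment> \<open>The exponent that \<open>Lp_imp_pointwise_bound\<close> yields for $s^\beta k(s)$; the one for $s^\beta l(s)$ becomes the same
      after multiplication with the growth $s^{(\beta-1)\mu}$ of $\phi(x(s))$.\<close>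
  define e where "e = 2 * \<beta> - 1 - 1 / p"
  interpret abel \<beta> e by unfold_locales (use assms(1,2) p in \<open>auto simp: e_def\<close>)
  define L where "L t = t powr \<beta> * l t" for t
  define K where "K t = t powr \<beta> * k t" for t
  obtain CL where CL: "0 \<le> CL" "\<And>s. 0 < s \<Longrightarrow> s \<le> 1 \<Longrightarrow> L s \<le> CL * s powr (\<beta> - (1 - \<mu>) * (1 - \<beta>) - 1 / p)"
    unfolding L_def using Lp_imp_pointwise_bound[OF p(1) l_nonneg l_anti assms(15)] by blast
  obtain CK where CK: "0 \<le> CK" "\<And>s. 0 < s \<Longrightarrow> s \<le> 1 \<Longrightarrow> K s \<le> CK * s powr (\<beta> - (1 - \<beta>) - 1 / p)"
    unfolding K_def using Lp_imp_pointwise_bound[OF p(1) k_nonneg k_anti assms(19)] by blast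
  define B where "B = Beta (1 - \<beta> + e) \<beta> / Gamma \<beta>"
  have "0 \<le> B" using Beta_pos[of "1 - \<beta> + e" \<beta>] Gamma_beta_pos beta e by (simp add: B_def)
  obtain R where R: "1 \<le> R" "(x0 + CK * B) + (CL * M * B) * R powr \<mu> \<le> R"
    using sublinear_bound_exists[of "x0 + CK * B" "CL * M * B" \<mu>] assms(3,4,5,10) CL(1) CK(1) \<open>0 \<le> B\<close> by auto
  define C where "C = CL * (M * R powr \<mu>) + CK"
  have RC: "x0 + C * Beta (1 - \<beta> + e) \<beta> / Gamma \<beta> \<le> R"
  proof -
    have "C * Beta (1 - \<beta> + e) \<beta> / Gamma \<beta> = C * B" by (simp add: B_def)
    then show ?thesis using R(2) by (simp add: C_def algebra_simps)
  qed
  define f where "f s y = L s * \<phi> y + K s" for s y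
  have f_profile: "profile e C (\<lambda>s. f s (x s))" if x: "profile (\<beta> - 1) R x" for x
    unfolding profile_def
  proof (intro conjI allI impI)
    have x0: "0 \<le> x s" if "0 < s" for s using x that by (simp add: profile_def)
    show "antimono_on {0<..} (\<lambda>s. f s (x s))"
    proof (rule monotone_onI)
      fix s t :: real assume st: "s \<in> {0<..}" "t \<in> {0<..}" "s \<le> t"
      then have "x t \<le> x s" using x by (simp add: profile_def monotone_on_def)
      then have "\<phi> (x t) \<le> \<phi> (x s)" using x0 st by (intro mono_onD[OF phi_mono]) auto
      moreover have "L t \<le> L s" "K t \<le> K s" "0 \<le> L s"
        using l_anti k_anti l_nonneg st by (auto simp: monotone_on_def L_def K_def)
      ultimately show "f t (x t) \<le> f s (x s)"
        unfolding f_def using phi_nonneg x0 st by (intro add_mono mult_mono) auto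
    qed
    show "0 \<le> f s (x s)" if "0 < s" for s
      using l_nonneg k_nonneg phi_nonneg x0 that by (simp add: f_def L_def K_def)
    show "f s (x s) \<le> C * s powr e" if "0 < s \<and> s \<le> 1" for s
    proof -
      have s: "0 < s" "s \<le> 1" using that by auto
      have Rs: "0 < R * s powr (\<beta> - 1)" using R s by simp
      \<comment> \<open>Monotonicity of $\phi$ moves the estimate to a positive argument, where the convention for $0^0$ does not matter.\<close>
      have "\<phi> (x s) \<le> \<phi> (R * s powr (\<beta> - 1))"
        using x x0 s Rs by (intro mono_onD[OF phi_mono]) (auto simp: profile_def)
      also have "\<dots> \<le> M * rpow (R * s powr (\<beta> - 1)) \<mu>"
        using phi_growth Rs by (smt (verit))
      also have "rpow (R * s powr (\<beta> - 1)) \<mu> = R powr \<mu> * s powr ((\<beta> - 1) * \<mu>)"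
        using Rs R s by (auto simp: rpow_def powr_mult powr_powr)
      finally have "L s * \<phi> (x s) \<le> (CL * s powr (\<beta> - (1 - \<mu>) * (1 - \<beta>) - 1 / p)) * (M * (R powr \<mu> * s powr ((\<beta> - 1) * \<mu>)))"
        using CL s x0 phi_nonneg by (intro mult_mono) auto
      also have "\<dots> = CL * (M * R powr \<mu>) * (s powr (\<beta> - (1 - \<mu>) * (1 - \<beta>) - 1 / p) * s powr ((\<beta> - 1) * \<mu>))"
        by (simp add: mult_ac)
      also have "s powr (\<beta> - (1 - \<mu>) * (1 - \<beta>) - 1 / p) * s powr ((\<beta> - 1) * \<mu>) = s powr e"
        unfolding powr_add[symmetric] by (rule arg_cong[of _ _ "(powr) s"]) (simp add: e_def algebra_simps)
      finally have "L s * \<phi> (x s) \<le> CL * (M * R powr \<mu>) * s powr e" .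
      moreover have "K s \<le> CK * s powr e" using CK(2)[OF s] by (simp add: e_def)
      ultimately show ?thesis by (simp add: f_def C_def distrib_right)
    qed
  qed
  have f_mono: "mono_on {0..} (f s)" if "0 < s" for s
  proof -
    have "0 \<le> L s" using l_nonneg that by (simp add: L_def)
    then show ?thesis using phi_mono by (auto simp: f_def monotone_on_def intro!: mult_left_mono)
  qed
  have f_cont: "continuous_on {0..} (f s)" for s
    unfolding f_def[abs_def] by (intro continuous_intros phi_cont)
  obtain x where x: "profile (\<beta> - 1) R x"
    and x_eq: "\<And>t. 0 < t \<Longrightarrow> x t = x0 * t powr (\<beta> - 1) + abel_mean \<beta> (\<lambda>s. f s (x s)) t"
  proof (rule monotone_iteration[of R C f x0])
    show "0 \<le> x0" "0 \<le> R" using assms(3) R(1) by auto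
  qed (use f_profile f_mono f_cont RC in blast)+
  define G where "G s = f s (x s)" for s
  have G: "profile e C G" unfolding G_def[abs_def] by (rule f_profile[OF x])
  have x_eq: "x t = x0 * t powr (\<beta> - 1) + abel_mean \<beta> G t" if "0 < t" for t
    using x_eq[OF that] by (simp add: G_def[abs_def])
  have x_nonneg: "0 \<le> x t" if "0 < t" for t using x that by (simp add: profile_def)
  have "continuous_on {0<..} (\<lambda>t. x0 * t powr (\<beta> - 1) + abel_mean \<beta> G t)"
    by (intro continuous_intros abel_mean_continuous[OF G]) auto
  then have x_cont: "continuous_on {0<..} x"
    by (rule continuous_on_eq) (simp add: x_eq)
  have G_cont: "continuous_on {0<..} G"
    unfolding G_def[abs_def] f_def L_def K_def
    by (intro continuous_intros l_cont k_cont continuous_on_compose2[OF phi_cont x_cont]) (auto intro: x_nonneg)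

  have x_init: "((\<lambda>t. t powr (1 - \<beta>) * x t) \<longlongrightarrow> x0) (at_right 0)"
  proof -
    have "((\<lambda>t. x0 + t powr (1 - \<beta>) * abel_mean \<beta> G t) \<longlongrightarrow> x0 + 0) (at_right 0)"
      by (intro tendsto_add tendsto_const abel_mean_at_right_0[OF G])
    moreover have "\<forall>\<^sub>F t in at_right 0. x0 + t powr (1 - \<beta>) * abel_mean \<beta> G t = t powr (1 - \<beta>) * x t"
      using eventually_at_right_less[of "0::real"]
    proof eventually_elim
      case (elim t)
      have "t powr (1 - \<beta>) * t powr (\<beta> - 1) = 1" using elim by (simp add: powr_add[symmetric])
      then show ?case using x_eq[OF elim] by (simp add: algebra_simps)
    qed
    ultimately show ?thesis by (simp add: filterlim_cong)
  qed

  have x_C_plus: "x \<in> C_plus (1 - \<beta>)"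
    unfolding C_plus_def mem_Collect_eq
  proof (intro conjI exI[of _ "\<lambda>t. if t \<le> 0 then x0 else t powr (1 - \<beta>) * x t"] allI impI)
    let ?g = "\<lambda>t. if t \<le> 0 then x0 else t powr (1 - \<beta>) * x t"
    show "continuous_on {0..} ?g"
      unfolding continuous_on_def
    proof
      fix t :: real assume "t \<in> {0..}"
      then consider "t = 0" | "0 < t" by fastforce
      then show "(?g \<longlongrightarrow> ?g t) (at t within {0..})"
      proof cases
        case 1
        have "\<forall>\<^sub>F t in at_right 0. t powr (1 - \<beta>) * x t = ?g t"
          using eventually_at_right_less[of "0::real"] by eventually_elim auto
        with x_init have "(?g \<longlongrightarrow> x0) (at_right 0)" by (rule Lim_transform_eventually)
        then show ?thesis using 1 by (simp add: at_within_Ici_at_right)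
      next
        case 2
        have "continuous_on {0<..} (\<lambda>t. t powr (1 - \<beta>) * x t)"
          by (intro continuous_intros x_cont) auto
        then have "continuous_on {0<..} ?g" by (rule continuous_on_eq) auto
        then have "isCont ?g t" using 2 by (simp add: continuous_on_eq_continuous_at)
        then show ?thesis unfolding isCont_def by (rule tendsto_within_subset) auto
      qed
    qed
  qed (use x_cont x_nonneg assms(3) in auto)

  have derivative: "has_rl_derivative \<beta> x (\<lambda>t. l t * \<phi> (x t) + k t)"
  proof -
    have "t powr (-\<beta>) * G t = l t * \<phi> (x t) + k t" if "0 < t" for t
      using that by (simp add: G_def f_def L_def K_def powr_minus field_simps)
    then show ?thesis
      using abel_has_rl_derivative[OF G G_cont _ x_eq] assms(3) by (simp add: has_rl_derivative_def)
  qed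

  have x_strict: "strict_antimono_on {0<..} x"
  proof (rule monotone_onI)
    fix s t :: real assume st: "s \<in> {0<..}" "t \<in> {0<..}" "s < t"
    then have "t powr (\<beta> - 1) < s powr (\<beta> - 1)" using beta by (intro powr_less_mono2_neg) auto
    then have "x0 * t powr (\<beta> - 1) < x0 * s powr (\<beta> - 1)" using assms(3) by simp
    then show "x t < x s" using st abel_mean_antimono[OF G, of s t] by (simp add: x_eq)
  qed

  have x_lim: "(x \<longlongrightarrow> \<kappa>) at_top"
  proof -
    obtain c where c: "0 \<le> c" "(x \<longlongrightarrow> c) at_top"
      using antimono_tendsto_at_top[of x] x x_nonneg by (auto simp: profile_def)
    have "((\<lambda>s. \<phi> (x s)) \<longlongrightarrow> \<phi> c) at_top"
    proof (rule continuous_on_tendsto_compose[OF phi_cont c(2)])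
      show "\<forall>\<^sub>F s in at_top. x s \<in> {0..}"
        using eventually_gt_at_top[of "0::real"] by eventually_elim (simp add: x_nonneg)
    qed (use c in simp)
    then have "(G \<longlongrightarrow> a * \<phi> c + b) at_top"
      unfolding G_def[abs_def] f_def L_def K_def by (intro tendsto_intros assms(20,21))
    from abel_mean_at_top[OF G this]
    have "((\<lambda>t. x0 * t powr (\<beta> - 1) + abel_mean \<beta> G t) \<longlongrightarrow> x0 * 0 + Gamma (1 - \<beta>) * (a * \<phi> c + b)) at_top"
      using beta by (intro tendsto_add tendsto_mult tendsto_const tendsto_neg_powr filterlim_ident) auto
    moreover have "\<forall>\<^sub>F t in at_top. x0 * t powr (\<beta> - 1) + abel_mean \<beta> G t = x t"
      using eventually_gt_at_top[of "0::real"] by eventually_elim (simp add: x_eq)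
    ultimately have "(x \<longlongrightarrow> Gamma (1 - \<beta>) * (a * \<phi> c + b)) at_top"
      by (simp add: filterlim_cong)
    then have "c = Gamma (1 - \<beta>) * (a * \<phi> c + b)"
      using c(2) tendsto_unique trivial_limit_at_top_linorder by blast
    also have "Gamma (1 - \<beta>) = pi / (Gamma \<beta> * sin (\<beta> * pi))"
    proof -
      have "Gamma (1 - \<beta>) = Gamma \<beta> * Gamma (1 - \<beta>) / Gamma \<beta>" using Gamma_beta_pos by simp
      then show ?thesis by (simp add: Gamma_reflection_real mult.commute)
    qed
    finally have "c = \<kappa>" using assms(24) c(1) by blast
    then show ?thesis using c(2) by simp
  qed

  show ?thesis
    using x_C_plus derivative x_init x_strict x_lim by (auto simp: rl_ivp_solution_def)
qed

end
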